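(* Let $-1<\nu<0$. Then $$\sum_{k \ge 1} \frac{1}{\Big[\big[(j_0^{\nu})'\big]^2 + \big(j_k^{\nu+1}\big)^2 \Big]^2} = \frac{1}{4\nu^2} + \frac{1}{4\big[(j_0^{\nu})' \big]^2} - \frac{\nu+1}{\big[(j_0^{\nu})'\big]^4}.$$
   Context: For $\mu>-1$, $\{j_n^{\mu}: n\ge1\}$ denotes the sequence of strictly positive zeros, in ascending order, of the Bessel function of the first kind $J_\mu$. For $-1<\nu<0$, $(j_0^{\nu})'$ denotes the unique strictly positive zero of $I_\nu'$, the derivative of the modified Bessel function of the first kind $I_\nu$. *)

theory Defs
  imports "HOL-Analysis.Analysis"
begin

text \<open>
  Bessel functions of real order, given by their Frobenius series and intended for
  arguments \<open>x > 0\<close> only.  Using \<open>rGamma = 1 / Gamma\<close> (entire) makes the formulas meaningful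
  for every real order.
\<close>

definition bessel_J :: "real \<Rightarrow> real \<Rightarrow> real" where
  "bessel_J \<mu> x = (x / 2) powr \<mu> *
     (\<Sum>k. (-1) ^ k * rGamma (\<mu> + real k + 1) / fact k * (x / 2) ^ (2 * k))"

definition bessel_I :: "real \<Rightarrow> real \<Rightarrow> real" where
  "bessel_I \<nu> x = (x / 2) powr \<nu> *
     (\<Sum>k. rGamma (\<nu> + real k + 1) / fact k * (x / 2) ^ (2 * k))"

text \<open>
  The \<open>n\<close>-th strictly positive zero of \<open>bessel_J \<mu>\<close> in ascending order, for \<open>n \<ge> 1\<close>: the zero
  having exactly \<open>n\<close> zeros in \<open>(0, x]\<close>.  Since infinite sets have cardinality 0, finiteness
  is implied for \<open>n \<ge> 1\<close>; the value at \<open>n = 0\<close> has no meaning.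
\<close>

definition bessel_J_zero :: "real \<Rightarrow> nat \<Rightarrow> real" where
  "bessel_J_zero \<mu> n =
     (THE x. 0 < x \<and> bessel_J \<mu> x = 0 \<and> card {y. 0 < y \<and> y \<le> x \<and> bessel_J \<mu> y = 0} = n)"

text \<open>Only meaningful for \<open>-1 < \<nu> < 0\<close>, where the zero exists and is unique.\<close>

definition bessel_I_deriv_zero :: "real \<Rightarrow> real" where
  "bessel_I_deriv_zero \<nu> = (THE x. 0 < x \<and> deriv (bessel_I \<nu>) x = 0)"

end

theory Submission
  imports Defs "HOL-Computational_Algebra.Polynomial" "HOL-Real_Asymp.Real_Asymp"
begin

text \<open>
  Put \<open>F m z = (\<Sum>k. z^k / (k! Gamma (m + k + 1)))\<close>.  Then \<open>J_m x = (x/2)^m F m (-x\<^sup>2/4)\<close> and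
  \<open>I_m x = (x/2)^m F m (x\<^sup>2/4)\<close>.  The heart of the matter is the partial fraction expansion of the
  second logarithmic derivative of \<open>F m\<close> with \<open>m = \<nu> + 1\<close>: for \<open>t > 0\<close>,
  \<open>(\<Sum>x. 1 / (t + x)\<^sup>2) = (F (m+1) t / F m t)\<^sup>2 - F (m+2) t / F m t\<close>,
  where \<open>x\<close> runs over the numbers \<open>j\<^sup>2/4\<close> for the positive zeros \<open>j\<close> of \<open>J_m\<close>
  (lemma \<open>bessel_zeros_has_sum\<close>).  With \<open>t = a\<^sup>2/4\<close>, where \<open>a\<close> is the zero of \<open>I_\<nu>'\<close>, the left-hand
  side is \<open>16\<close> times the series of the theorem.  The condition \<open>I_\<nu>' a = 0\<close> is linear in \<open>F \<nu> t\<close> and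
  \<open>F (\<nu>+1) t\<close>, so that it determines their quotient, and by the three-term recurrence also the
  quotients on the right-hand side (lemma \<open>neg_log_deriv2_at_deriv_zero\<close>).

  The expansion is obtained by real methods, without factorisation of entire functions.  Suitably
  scaled Laguerre polynomials converge to \<open>F m (-x)\<close>, with derivatives, uniformly on compact
  intervals, and by Rolle's theorem all their zeros are real, simple and positive
  (lemma \<open>laguerre_roots\<close>).  For polynomials the expansion is elementary.  The sum of the reciprocals of
  the zeros is \<open>1 / (m + 1)\<close> for every one of these polynomials, so the zeros beyond \<open>R\<close> contribute
  \<open>O(1/R)\<close> to the sum, uniformly in the degree.  The zeros below \<open>R\<close> converge to those of the limit
  (lemma \<open>real_Hurwitz_sum\<close>), because the zeros of \<open>F m\<close> are simple by the differential equation
  (lemma \<open>bessel_series_zero_simple\<close>).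

  It remains to see that the enumeration of the zeros of \<open>J_m\<close> is meaningful: only finitely many lie
  in each bounded interval, and there are infinitely many, since otherwise the expansion contradicts
  the Riccati equation of \<open>F' / F\<close> at infinity (lemma \<open>infinite_bessel_zeros\<close>).
\<close>

section \<open>The entire function behind the Bessel functions\<close>

text \<open>
  The regularised confluent function \<open>0F1(; m + 1; z) / Gamma (m + 1)\<close>.  In the variable
  \<open>z = \<plusminus>x\<^sup>2/4\<close> the functions \<open>I\<close> and \<open>J\<close> share one entire function, differentiation in \<open>z\<close> only
  shifts the order \<open>m\<close>.
\<close>
definition bessel_coeff :: "real \<Rightarrow> nat \<Rightarrow> real" where
  "bessel_coeff m k = rGamma (m + real k + 1) / fact k"

definition bessel_series :: "real \<Rightarrow> real \<Rightarrow> real" where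
  "bessel_series m z = (\<Sum>k. bessel_coeff m k * z ^ k)"

lemma bessel_coeff_Suc:
  "(m + real k + 1) * (real k + 1) * bessel_coeff m (Suc k) = bessel_coeff m k"
proof -
  define r where "r = rGamma (m + real k + 1 + 1)"
  have r: "rGamma (m + real k + 1) = (m + real k + 1) * r"
    using rGamma_plus1[of "m + real k + 1"] by (simp add: r_def)
  have r': "rGamma (m + real (Suc k) + 1) = r" by (simp add: r_def algebra_simps)
  show ?thesis
    unfolding bessel_coeff_def r r' by (simp add: divide_simps)
qed

lemma bessel_coeff_pos:
  assumes "m > -1" shows "bessel_coeff m k > 0"
  using assms by (simp add: bessel_coeff_def rGamma_inverse_Gamma)

lemma summable_bessel_coeff: "summable (\<lambda>k. bessel_coeff m k * z ^ k)"
proof -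
  obtain N :: nat where N: "real N > \<bar>m\<bar> + 2 * \<bar>z\<bar>"
    using reals_Archimedean2 by blast
  show ?thesis
  proof (rule summable_ratio_test[of "1/2" N])
    fix n assume n: "N \<le> n"
    define c where "c = (m + real n + 1) * (real n + 1)"
    have c: "c \<ge> 2 * \<bar>z\<bar>"
    proof -
      have "1 * (2 * \<bar>z\<bar>) \<le> c"
        unfolding c_def using N n by (intro mult_mono) auto
      thus ?thesis by simp
    qed
    have c0: "c > 0" unfolding c_def using N n by (intro mult_pos_pos) auto
    have "bessel_coeff m n = c * bessel_coeff m (Suc n)"
      using bessel_coeff_Suc[of m n] by (simp add: c_def)
    hence "norm (bessel_coeff m n * z ^ n) = c * (\<bar>bessel_coeff m (Suc n)\<bar> * \<bar>z\<bar> ^ n)"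
      using c0 by (simp add: abs_mult power_abs)
    moreover have "2 * \<bar>z\<bar> * (\<bar>bessel_coeff m (Suc n)\<bar> * \<bar>z\<bar> ^ n) \<le> c * (\<bar>bessel_coeff m (Suc n)\<bar> * \<bar>z\<bar> ^ n)"
      by (intro mult_right_mono c) auto
    ultimately show "norm (bessel_coeff m (Suc n) * z ^ Suc n) \<le> 1/2 * norm (bessel_coeff m n * z ^ n)"
      by (simp only: norm_mult real_norm_def abs_mult power_abs power_Suc) (simp add: algebra_simps)
  qed auto
qed

lemma diffs_bessel_coeff: "diffs (bessel_coeff m) = bessel_coeff (m + 1)"
  by (rule ext) (simp add: diffs_def bessel_coeff_def field_simps del: of_nat_Suc, simp add: algebra_simps)

lemma DERIV_bessel_series:
  "(bessel_series m has_real_derivative bessel_series (m + 1) z) (at z)"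
  unfolding bessel_series_def
  using termdiffs_strong_converges_everywhere[of "bessel_coeff m" z] summable_bessel_coeff
  by (simp add: diffs_bessel_coeff)

lemmas DERIV_bessel_series' [derivative_intros] = DERIV_chain2[OF DERIV_bessel_series]

lemma isCont_bessel_series: "isCont (bessel_series m) z"
  by (rule DERIV_isCont[OF DERIV_bessel_series])

lemma bessel_series_0: "bessel_series m 0 = rGamma (m + 1)"
  unfolding bessel_series_def using powser_zero[of "bessel_coeff m"] by (simp add: bessel_coeff_def)

lemma bessel_series_0_pos: "m > -1 \<Longrightarrow> bessel_series m 0 > 0"
  by (simp add: bessel_series_0 rGamma_inverse_Gamma)

lemma bessel_series_ge_0:
  assumes "m > -1" "z \<ge> 0" shows "bessel_series m z \<ge> bessel_series m 0"
proof -
  have "bessel_coeff m 0 * z ^ 0 \<le> bessel_series m z"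
    using sum_le_suminf[OF summable_bessel_coeff, of "{0}" m z] assms bessel_coeff_pos[OF assms(1)]
    by (simp add: bessel_series_def less_imp_le)
  thus ?thesis by (simp add: bessel_series_0 bessel_coeff_def)
qed

lemma bessel_series_pos: "m > -1 \<Longrightarrow> z \<ge> 0 \<Longrightarrow> bessel_series m z > 0"
  using bessel_series_ge_0[of m z] bessel_series_0_pos[of m] by linarith

text \<open>
  With the derivative rule, this is the differential equation \<open>z F'' + (m + 1) F' = F\<close>.
\<close>
lemma bessel_series_rec:
  "bessel_series m z = (m + 1) * bessel_series (m + 1) z + z * bessel_series (m + 2) z"
proof -
  define c where "c = bessel_coeff (m + 1)"
  have c: "bessel_coeff m k = (m + 1) * c k + real k * c k" for k
    using rGamma_plus1[of "m + real k + 1"]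
    by (simp add: c_def bessel_coeff_def field_simps)
  have s: "summable (\<lambda>k. c k * z ^ k)" unfolding c_def by (rule summable_bessel_coeff)
  have d: "real (Suc k) * c (Suc k) = bessel_coeff (m + 2) k" for k
    using fun_cong[OF diffs_bessel_coeff[of "m+1"], of k]
    by (simp add: c_def diffs_def algebra_simps)
  have e: "real (Suc k) * c (Suc k) * z ^ Suc k = z * (bessel_coeff (m + 2) k * z ^ k)" for k
    unfolding d by simp
  have sd: "(\<lambda>k. real (Suc k) * c (Suc k) * z ^ Suc k) sums (z * bessel_series (m + 2) z)"
    unfolding e bessel_series_def by (intro sums_mult summable_sums summable_bessel_coeff)
  hence sd': "(\<lambda>k. real k * c k * z ^ k) sums (z * bessel_series (m + 2) z)"
    by (subst (asm) sums_Suc_iff) simp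
  have "(\<lambda>k. (m + 1) * (c k * z ^ k) + real k * c k * z ^ k)
     sums ((m + 1) * bessel_series (m + 1) z + z * bessel_series (m + 2) z)"
    using sd' s unfolding bessel_series_def[of "m+1"] c_def[symmetric]
    by (intro sums_add sums_mult summable_sums) 
  moreover have "(m + 1) * (c k * z ^ k) + real k * c k * z ^ k = bessel_coeff m k * z ^ k" for k
    unfolding c by (simp add: algebra_simps)
  ultimately show ?thesis
    unfolding bessel_series_def[of m] using sums_unique by force
qed

lemma bessel_J_eq: "bessel_J m x = (x / 2) powr m * bessel_series m (- (x\<^sup>2 / 4))"
proof -
  have "(- (x\<^sup>2 / 4)) ^ k = (-1) ^ k * (x / 2) ^ (2 * k)" for k
    by (simp add: power_mult power_divide power_minus[of "x\<^sup>2/4"])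
  thus ?thesis
    unfolding bessel_J_def bessel_series_def bessel_coeff_def by (simp add: mult_ac)
qed

lemma bessel_I_eq: "bessel_I m x = (x / 2) powr m * bessel_series m (x\<^sup>2 / 4)"
proof -
  have "(x\<^sup>2 / 4) ^ k = (x / 2) ^ (2 * k)" for k
    by (simp add: power_mult power_divide)
  thus ?thesis
    unfolding bessel_I_def bessel_series_def bessel_coeff_def by (simp add: mult_ac)
qed

text \<open>
  Uniqueness for the initial value problem, by an energy argument: with \<open>f u = F (-u)\<close>, the
  quantity \<open>u f'\<^sup>2 + f\<^sup>2\<close> may decrease, but its derivative is \<open>-(2 m + 1) f'\<^sup>2\<close>, so that multiplying
  it by a sufficiently high power of \<open>u\<close> makes it nondecreasing.  If it vanished at a double zero \<open>x\<close>,
  then it would vanish on all of \<open>(0, x)\<close>, and \<open>f 0 = 0\<close> by continuity, which is false.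
\<close>
lemma bessel_series_zero_simple:
  assumes m: "m > -1" and x: "x > 0" and zero: "bessel_series m (-x) = 0"
  shows "bessel_series (m + 1) (-x) \<noteq> 0"
proof
  assume zero': "bessel_series (m + 1) (-x) = 0"
  obtain K :: nat where K: "real K > 2 * m + 1" using reals_Archimedean2 by blast
  define f where "f = (\<lambda>u. bessel_series m (-u))"
  define g where "g = (\<lambda>u. - bessel_series (m + 1) (-u))"
  have f': "(f has_real_derivative g u) (at u)" for u
    unfolding f_def g_def by (auto intro!: derivative_eq_intros)
  have g': "(g has_real_derivative bessel_series (m + 2) (-u)) (at u)" for u
    unfolding g_def by (auto intro!: derivative_eq_intros simp: add.assoc)
  have ode: "u * bessel_series (m + 2) (-u) = - (m + 1) * g u - f u" for u
    using bessel_series_rec[of m "-u"] by (simp add: f_def g_def algebra_simps)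
  define E where "E = (\<lambda>u. u ^ (K+1) * (u * (g u)\<^sup>2 + (f u)\<^sup>2))"
  define E' where "E' = (\<lambda>u. u ^ K * (real (K + 1) * (u * (g u)\<^sup>2 + (f u)\<^sup>2) - (2 * m + 1) * (u * (g u)\<^sup>2)))"
  have dE: "(E has_real_derivative E' u) (at u)" for u
  proof -
    define q where "q = (\<lambda>u::real. u ^ (K+1))"
    have q: "(q has_real_derivative real (K+1) * u ^ K) (at u)"
      unfolding q_def using DERIV_pow[of "K+1" u] by simp
    have Eq: "E = (\<lambda>u. q u * (u * (g u)\<^sup>2 + (f u)\<^sup>2))" by (simp add: E_def q_def)
    have "(E has_real_derivative real (K+1) * u ^ K * (u * (g u)\<^sup>2 + (f u)\<^sup>2) +
       q u * ((g u)\<^sup>2 + 2 * g u * (u * bessel_series (m + 2) (-u)) + 2 * f u * g u)) (at u)"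
      unfolding Eq
      by (auto intro!: derivative_eq_intros q f' g' simp: algebra_simps power2_eq_square)
    also have "real (K+1) * u ^ K * (u * (g u)\<^sup>2 + (f u)\<^sup>2) +
       q u * ((g u)\<^sup>2 + 2 * g u * (u * bessel_series (m + 2) (-u)) + 2 * f u * g u) = E' u"
      unfolding ode E'_def q_def by (simp add: algebra_simps power2_eq_square)
    finally show ?thesis .
  qed
  have "E u = 0" if u: "0 < u" "u < x" for u
  proof -
    have "E u \<le> E x"
    proof (rule DERIV_nonneg_imp_nondecreasing[of u x E])
      fix v assume v: "u \<le> v" "v \<le> x"
      have "(2 * m + 1) * (v * (g v)\<^sup>2) \<le> real (K + 1) * (v * (g v)\<^sup>2)"
        using K v u by (intro mult_right_mono) auto
      also have "\<dots> \<le> real (K + 1) * (v * (g v)\<^sup>2 + (f v)\<^sup>2)"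
        by (intro mult_left_mono) auto
      finally have "E' v \<ge> 0" unfolding E'_def using v u by simp
      thus "\<exists>y. (E has_real_derivative y) (at v) \<and> 0 \<le> y" using dE by blast
    qed (use u in auto)
    also have "E x = 0" using zero zero' by (simp add: E_def f_def g_def)
    finally have "E u \<le> 0" .
    moreover have "E u \<ge> 0" using u by (simp add: E_def)
    ultimately show ?thesis by simp
  qed
  hence fz: "f u = 0" if u: "0 < u" "u < x" for u
  proof -
    have "u * (g u)\<^sup>2 + (f u)\<^sup>2 = 0" using \<open>\<And>u. _ \<Longrightarrow> _ \<Longrightarrow> E u = 0\<close>[OF u] u by (simp add: E_def)
    moreover have "u * (g u)\<^sup>2 \<ge> 0" "(f u)\<^sup>2 \<ge> 0" using u by auto
    ultimately have "(f u)\<^sup>2 = 0" by linarith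
    thus ?thesis by simp
  qed
  have "f \<midarrow>0\<rightarrow> f 0" using DERIV_isCont[OF f'[of 0]] by (simp add: isCont_def)
  hence "(f \<longlongrightarrow> f 0) (at_right 0)" by (rule filterlim_mono) (auto simp: at_le)
  moreover have "eventually (\<lambda>u. f u = 0) (at_right 0)"
    using eventually_at_right_less[of "0::real"] eventually_at_right_real[OF x] 
    by eventually_elim (use fz in auto)
  ultimately have "f 0 = 0"
    by (metis tendsto_eventually tendsto_unique trivial_limit_at_right_real)
  thus False using bessel_series_0_pos[OF m] by (simp add: f_def)
qed

section \<open>Laguerre polynomials have positive simple zeros\<close>

text \<open>
  If \<open>h b\<close> is not \<open>0\<close>, then the value \<open>h b / 2\<close> is attained on both sides of \<open>b\<close>, because \<open>h\<close> tends to
  \<open>0\<close> at both ends; the ordinary theorem applies between two such points.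
\<close>
lemma Rolle_at_top:
  fixes h :: "real \<Rightarrow> real"
  assumes a: "h a = 0" and lim: "(h \<longlongrightarrow> 0) at_top"
    and cont: "continuous_on {a..} h"
    and der: "\<And>u. u > a \<Longrightarrow> (h has_real_derivative h' u) (at u)"
  shows "\<exists>u>a. h' u = 0"
proof (cases "\<forall>u>a. h u = 0")
  case True
  have "((\<lambda>_. 0) has_real_derivative h' (a+1)) (at (a + 1))"
  proof (rule DERIV_cong_ev[THEN iffD1, OF refl _ refl])
    show "(h has_real_derivative h' (a+1)) (at (a+1))" using der by simp
    show "\<forall>\<^sub>F x in nhds (a+1). h x = 0"
      using eventually_nhds_in_open[of "{a<..}" "a+1"] True by (auto elim: eventually_mono)
  qed
  hence "h' (a+1) = 0" using DERIV_unique DERIV_const by blast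
  thus ?thesis by (intro exI[of _ "a+1"]) auto
next
  case False
  then obtain b where b: "b > a" "h b \<noteq> 0" by auto
  have main: "\<exists>u>a. h' u = 0" if s: "s = 1 \<or> s = -1" and pos: "s * h b > 0" for s
  proof -
    define g where "g = (\<lambda>u. s * h u)"
    have "(g \<longlongrightarrow> 0) at_top" unfolding g_def using tendsto_mult_left[OF lim, of s] by simp
    hence "eventually (\<lambda>u. g u < g b / 2) at_top"
      by (rule order_tendstoD) (use pos in \<open>auto simp: g_def\<close>)
    hence "eventually (\<lambda>u. g u < g b / 2 \<and> u > b) at_top"
      using eventually_gt_at_top by (rule eventually_conj)
    then obtain c where c: "g c < g b / 2" "c > b" using eventually_happens by force
    have gc: "continuous_on {u..v} g" if "u \<ge> a" for u v
      unfolding g_def using that by (intro continuous_intros continuous_on_subset[OF cont]) auto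
    obtain d where d: "a \<le> d" "d \<le> b" "g d = g b / 2"
      using IVT'[of g a "g b / 2" b] gc a b pos by (auto simp: g_def)
    obtain e where e: "b \<le> e" "e \<le> c" "g e = g b / 2"
      using IVT2'[of g c "g b / 2" b] gc b c pos by (auto simp: g_def)
    have "d \<noteq> a" using d a pos by (auto simp: g_def)
    have "b \<noteq> d" using d pos by (auto simp: g_def)
    hence de: "a < d" "d < e" using d e \<open>d \<noteq> a\<close> by auto
    have "\<exists>l z. d < z \<and> z < e \<and> DERIV h z :> l \<and> h e - h d = (e - d) * l"
      using de by (intro MVT continuous_on_subset[OF cont]) (auto intro!: exI der simp: real_differentiable_def)
    then obtain l z where z: "d < z" "z < e" "DERIV h z :> l" "h e - h d = (e - d) * l" by blast
    have "h e = h d" using d e s by (auto simp: g_def)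
    hence "l = 0" using z de by simp
    moreover have "l = h' z" using DERIV_unique[OF z(3) der] z de by auto
    ultimately show ?thesis using z de by (intro exI[of _ z]) auto
  qed
  show ?thesis using main[of 1] main[of "-1"] b by (cases "h b > 0") auto
qed

text \<open>
  The zeros of \<open>h\<close>, including \<open>a\<close> and infinity, bound \<open>card S + 1\<close> gaps; each gap contains a zero
  of the derivative.
\<close>
lemma Rolle_count_at_top:
  fixes h :: "real \<Rightarrow> real"
  assumes fin: "finite S" and S: "\<And>x. x \<in> S \<Longrightarrow> x > a \<and> h x = 0"
    and a: "h a = 0" and lim: "(h \<longlongrightarrow> 0) at_top"
    and cont: "continuous_on {a..} h"
    and der: "\<And>u. u > a \<Longrightarrow> (h has_real_derivative h' u) (at u)"
  obtains T where "finite T" "card T = Suc (card S)" "\<And>u. u \<in> T \<Longrightarrow> u > a \<and> h' u = 0"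
proof -
  have "\<exists>u>x. h' u = 0 \<and> (\<forall>y\<in>S. y > x \<longrightarrow> u < y)" if x: "x \<in> insert a S" for x
  proof (cases "\<exists>y\<in>S. y > x")
    case False
    have "\<exists>u>x. h' u = 0"
    proof (rule Rolle_at_top[OF _ lim])
      have xa: "x \<ge> a" using x S by force
      thus "continuous_on {x..} h" by (intro continuous_on_subset[OF cont]) auto
      show "h x = 0" using x S a by auto
      show "(h has_real_derivative h' u) (at u)" if "u > x" for u using that xa der by auto
    qed
    thus ?thesis using False by auto
  next
    case True
    define y where "y = Min {y\<in>S. y > x}"
    have "y \<in> {y\<in>S. y > x}" unfolding y_def by (rule Min_in) (use True fin in auto)
    hence y: "y \<in> S" "y > x" by auto
    have ymin: "y \<le> y'" if "y' \<in> S" "y' > x" for y'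
      unfolding y_def using that fin by (intro Min_le) auto
    have xa: "x \<ge> a" using x S by force
    have "\<exists>l z. x < z \<and> z < y \<and> DERIV h z :> l \<and> h y - h x = (y - x) * l"
      using y xa by (intro MVT continuous_on_subset[OF cont]) (auto intro!: exI der simp: real_differentiable_def)
    then obtain l z where z: "x < z" "z < y" "DERIV h z :> l" "h y - h x = (y - x) * l" by blast
    have "h y = h x" using x y S a by auto
    hence "l = 0" using z y by simp
    moreover have "l = h' z" using DERIV_unique[OF z(3) der] z xa by auto
    ultimately show ?thesis using z ymin by (intro exI[of _ z]) force
  qed
  then obtain \<xi> where \<xi>: "\<And>x. x \<in> insert a S \<Longrightarrow> \<xi> x > x \<and> h' (\<xi> x) = 0 \<and> (\<forall>y\<in>S. y > x \<longrightarrow> \<xi> x < y)"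
    by metis
  have less: "\<xi> x < \<xi> y" if "x \<in> insert a S" "y \<in> insert a S" "x < y" for x y
  proof -
    have "y \<in> S" using that S by force
    thus ?thesis using \<xi>[OF that(1)] \<xi>[OF that(2)] that(3) by force
  qed
  have inj: "inj_on \<xi> (insert a S)"
    by (rule inj_onI) (metis less less_irrefl linorder_neqE_linordered_idom)
  have "a \<notin> S" using S by blast
  show ?thesis
  proof
    show "finite (\<xi> ` insert a S)" using fin by auto
    show "card (\<xi> ` insert a S) = Suc (card S)"
      using card_image[OF inj] \<open>a \<notin> S\<close> fin by simp
    show "u > a \<and> h' u = 0" if u: "u \<in> \<xi> ` insert a S" for u
    proof -
      obtain x where x: "x \<in> insert a S" "u = \<xi> x" using u by blast
      moreover have "x \<ge> a" using x S by force
      ultimately show ?thesis using \<xi>[OF x(1)] by auto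
    qed
  qed
qed

text \<open>
  The generalised Laguerre polynomial of degree \<open>n\<close> and parameter \<open>m\<close> in the variable \<open>y x\<close>,
  divided by \<open>Gamma (m + n + 1) / fact n\<close>.  With this normalisation the coefficients converge to those
  of \<open>bessel_series m (-x)\<close> for \<open>y = 1 / n\<close>.
\<close>
definition laguerre :: "real \<Rightarrow> real \<Rightarrow> nat \<Rightarrow> real poly" where
  "laguerre m y n = (\<Sum>k\<le>n. monom (real (n choose k) * rGamma (m + real k + 1) * (-y) ^ k) k)"

lemma coeff_laguerre: "coeff (laguerre m y n) k = real (n choose k) * rGamma (m + real k + 1) * (-y) ^ k"
  unfolding laguerre_def by (auto simp: coeff_sum sum.delta binomial_eq_0)

lemma degree_laguerre:
  assumes "m > -1" "y > 0" shows "degree (laguerre m y n) = n"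
proof (rule antisym)
  show "degree (laguerre m y n) \<le> n" by (rule degree_le) (auto simp: coeff_laguerre)
  have "m + real n + 1 > 0" using assms by linarith
  hence "rGamma (m + real n + 1) > 0" by (simp add: rGamma_inverse_Gamma)
  thus "n \<le> degree (laguerre m y n)" using assms by (intro le_degree) (simp add: coeff_laguerre)
qed

text \<open>
  This form of the recurrence exhibits the next polynomial, up to a positive factor, as the derivative
  of \<open>x powr c * exp (- y x) * L x\<close> with \<open>c = n + 1 + m\<close>, so that the zeros can be counted with Rolle's
  theorem.
\<close>
lemma laguerre_rec:
  "smult (real n + 1 + m) (laguerre m y (Suc n)) =
     pCons 0 (pderiv (laguerre m y n)) + [:real n + 1 + m, -y:] * laguerre m y n"
proof (rule poly_eqI)
  fix k
  show "coeff (smult (real n + 1 + m) (laguerre m y (Suc n))) k =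
     coeff (pCons 0 (pderiv (laguerre m y n)) + [:real n + 1 + m, -y:] * laguerre m y n) k"
  proof (cases k)
    case 0
    thus ?thesis by (simp add: coeff_laguerre)
  next
    case (Suc j)
    define r where "r = rGamma (m + real j + 2)"
    have r: "rGamma (m + real j + 1) = (m + real j + 1) * r"
      using rGamma_plus1[of "m + real j + 1"] by (simp add: r_def add.assoc)
    have r': "rGamma (m + real (Suc j) + 1) = r"
      unfolding r_def by (rule arg_cong[of _ _ rGamma]) simp
    have cf: "coeff (laguerre m y N) j = real (N choose j) * ((m + real j + 1) * r) * (-y) ^ j"
       "coeff (laguerre m y N) (Suc j) = real (N choose Suc j) * r * (-y) ^ Suc j" for N
      unfolding coeff_laguerre r r' by simp_all
    have absorb: "real (Suc n) * real (n choose Suc j) = real (Suc n - Suc j) * real (Suc n choose Suc j)"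
      by (metis binomial_absorb_comp diff_Suc_1 mult.commute of_nat_mult)
    have b: "real (Suc n) * real (n choose Suc j) = (real n - real j) * (real (n choose j) + real (n choose Suc j))"
    proof (cases "j \<le> n")
      case True thus ?thesis using absorb by (simp add: of_nat_diff)
    qed (auto simp: binomial_eq_0)
    have "(real n + 1 + m) * (real (n choose j) + real (n choose Suc j)) =
      real (n choose Suc j) * (1 + real j) + (real n + 1 + m) * real (n choose Suc j) + real (n choose j) * (m + real j + 1)"
      using b by (simp add: algebra_simps)
    hence "(real n + 1 + m) * (real (n choose j) + real (n choose Suc j)) * (r * (-y) ^ Suc j) =
      (real (n choose Suc j) * (1 + real j) + (real n + 1 + m) * real (n choose Suc j) + real (n choose j) * (m + real j + 1)) * (r * (-y) ^ Suc j)"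
      by simp
    thus ?thesis
      by (simp add: Suc coeff_pderiv cf algebra_simps)
  qed
qed

text \<open>
  Induction on the degree: the weighted polynomial in the proof vanishes at \<open>0\<close>, at infinity and at
  \<open>n\<close> positive points, so its derivative has \<open>n + 1\<close> positive zeros.
\<close>
lemma laguerre_roots:
  assumes m: "m > -1" and y: "y > 0"
  obtains S where "finite S" "card S = n" "\<And>x. x \<in> S \<Longrightarrow> x > 0 \<and> poly (laguerre m y n) x = 0"
proof -
  have "\<exists>S. finite S \<and> card S = n \<and> (\<forall>x\<in>S. x > 0 \<and> poly (laguerre m y n) x = 0)"
  proof (induction n)
    case 0 show ?case by (intro exI[of _ "{}"]) auto
  next
    case (Suc n)
    then obtain S where S: "finite S" "card S = n" "\<And>x. x \<in> S \<Longrightarrow> x > 0 \<and> poly (laguerre m y n) x = 0" by auto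
    define c where "c = real n + 1 + m"
    have c: "c > 0" using m by (simp add: c_def)
    define p where "p = laguerre m y n"
    define h where "h = (\<lambda>x. x powr c * exp (- y * x) * poly p x)"
    define h' where "h' = (\<lambda>x. x powr (c - 1) * exp (- y * x) * (x * poly (pderiv p) x + (c - y * x) * poly p x))"
    have lim: "(h \<longlongrightarrow> 0) at_top"
    proof -
      have "((\<lambda>x. x powr c * exp (- y * x) * x ^ k) \<longlongrightarrow> 0) at_top" for k
      proof -
        have "((\<lambda>x::real. x powr (c + real k) * exp (- y * x)) \<longlongrightarrow> 0) at_top"
          using y by real_asymp
        moreover have "eventually (\<lambda>x::real. x powr (c + real k) * exp (- y * x) = x powr c * exp (- y * x) * x ^ k) at_top"
          using eventually_gt_at_top[of 0] by eventually_elim (simp add: powr_add powr_realpow)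
        ultimately show ?thesis using filterlim_cong by fast
      qed
      hence "((\<lambda>x. \<Sum>k\<le>degree p. coeff p k * (x powr c * exp (- y * x) * x ^ k)) \<longlongrightarrow> (\<Sum>k\<le>degree p. coeff p k * 0)) at_top"
        by (intro tendsto_sum tendsto_mult tendsto_const)
      thus ?thesis by (simp add: h_def poly_altdef sum_distrib_left algebra_simps)
    qed
    have der: "(h has_real_derivative h' u) (at u)" if u: "u > 0" for u
    proof -
      have e: "u powr c = u * u powr (c - 1)" using u by (simp add: powr_diff)
      show ?thesis unfolding h_def h'_def
        using u by (auto intro!: derivative_eq_intros) (simp add: e algebra_simps)
    qed
    have h0: "h 0 = 0" by (simp add: h_def)
    have cont: "continuous_on {0..} h"
      unfolding h_def using c by (intro continuous_intros continuous_on_powr') auto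
    obtain T where T: "finite T" "card T = Suc (card S)" "\<And>u. u \<in> T \<Longrightarrow> u > 0 \<and> h' u = 0"
      by (rule Rolle_count_at_top[OF S(1), of 0 h h'])
         (use S(3) h0 lim der cont in \<open>auto simp: h_def p_def\<close>)
    have "poly (laguerre m y (Suc n)) u = 0" if "u \<in> T" for u
    proof -
      have "u * poly (pderiv p) u + (c - y * u) * poly p u = 0"
        using T(3)[OF that] by (auto simp: h'_def)
      hence "c * poly (laguerre m y (Suc n)) u = 0"
        using arg_cong[OF laguerre_rec[of n m y], of "\<lambda>p. poly p u"] by (simp add: c_def p_def algebra_simps)
      thus ?thesis using c by simp
    qed
    thus ?case using T S by (intro exI[of _ T]) auto
  qed
  thus ?thesis using that by blast
qed

section \<open>Limits of zeros and of logarithmic derivatives\<close>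

text \<open>
  Near a simple zero the derivatives of the approximants are eventually bounded away from \<open>0\<close>, so the
  approximants are strictly monotone there and have exactly one zero, which converges to \<open>z\<close>.
\<close>
lemma real_Hurwitz_local:
  fixes f f' :: "real \<Rightarrow> real" and p p' :: "nat \<Rightarrow> real \<Rightarrow> real"
  assumes lim: "uniform_limit {A..B} p f sequentially"
    and lim': "uniform_limit {A..B} p' f' sequentially"
    and dp: "\<And>n x. (p n has_real_derivative p' n x) (at x)"
    and df: "\<And>x. (f has_real_derivative f' x) (at x)"
    and cf': "continuous_on {A..B} f'"
    and z: "A < z" "z < B" "f z = 0" "f' z \<noteq> 0"
    and \<phi>: "isCont \<phi> z" and d: "d > 0"
  shows "\<exists>e. 0 < e \<and> e < d \<and> {z-e..z+e} \<subseteq> {A..B} \<and> (\<forall>x\<in>{z-e..z+e}. f x = 0 \<longrightarrow> x = z) \<and>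
     (\<lambda>n. \<Sum>x\<in>{x. z-e < x \<and> x < z+e \<and> p n x = 0}. \<phi> x) \<longlonglongrightarrow> (\<phi> z :: real)"
proof -
  define s where "s = sgn (f' z)"
  have s: "s = 1 \<or> s = -1" using z by (auto simp: s_def sgn_if)
  have pos: "s * f' z > 0" using z by (auto simp: s_def sgn_if)
  have cz: "continuous (at z) f'"
    using continuous_on_interior[OF cf'] z by simp
  hence "((\<lambda>x. s * f' x) \<longlongrightarrow> s * f' z) (at z)" unfolding continuous_at by (intro tendsto_intros)
  hence "eventually (\<lambda>x. s * f' x > s * f' z / 2) (at z)"
    by (rule order_tendstoD) (use pos in auto)
  then obtain r where r: "r > 0" "\<And>x. x \<noteq> z \<Longrightarrow> dist x z < r \<Longrightarrow> s * f' x > s * f' z / 2"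
    unfolding eventually_at by auto
  have r': "s * f' x > s * f' z / 2" if "\<bar>x - z\<bar> < r" for x
    using r(2)[of x] that pos by (cases "x = z") (auto simp: dist_real_def)
  define e where "e = Min {r/2, d/2, (z-A)/2, (B-z)/2}"
  have e0: "e > 0" using r(1) d z by (simp add: e_def)
  have el: "e \<le> r/2" "e \<le> d/2" "e \<le> (z-A)/2" "e \<le> (B-z)/2" unfolding e_def by (intro Min_le; simp)+
  have e: "e < r" "e < d" using el r(1) d by linarith+
  have sub: "{z-e..z+e} \<subseteq> {A..B}" using el z by auto
  have f'pos: "s * f' x > s * f' z / 2" if "x \<in> {z-e..z+e}" for x
    using r'[of x] that e by auto
  have smono: "s * f a < s * f b" if "a < b" "a \<in> {z-e..z+e}" "b \<in> {z-e..z+e}" for a b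
  proof (rule DERIV_pos_imp_increasing[OF that(1)])
    fix x assume "a \<le> x" "x \<le> b"
    hence "s * f' x > 0" using f'pos[of x] that pos by fastforce
    moreover have "((\<lambda>x. s * f x) has_real_derivative s * f' x) (at x)"
      by (rule DERIV_cmult[OF df])
    ultimately show "\<exists>y. ((\<lambda>x. s * f x) has_real_derivative y) (at x) \<and> 0 < y" by blast
  qed
  have uniq: "x = z" if "x \<in> {z-e..z+e}" "f x = 0" for x
    using smono[of x z] smono[of z x] that z e0 by (cases x z rule: linorder_cases) auto
  have mono: "\<forall>\<^sub>F n in sequentially. \<forall>x\<in>{z-e..z+e}. s * p' n x > 0"
  proof -
    have "\<forall>\<^sub>F n in sequentially. \<forall>x\<in>{A..B}. dist (p' n x) (f' x) < s * f' z / 2"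
      using uniform_limitD[OF lim', of "s * f' z / 2"] pos by simp
    thus ?thesis
    proof eventually_elim
      case (elim n)
      show ?case
      proof
        fix x assume x: "x \<in> {z-e..z+e}"
        have "dist (p' n x) (f' x) < s * f' z / 2" using elim x sub by blast
        thus "s * p' n x > 0" using f'pos[OF x] s by (auto simp: dist_real_def abs_if split: if_splits)
      qed
    qed
  qed
  have inj: "\<forall>\<^sub>F n in sequentially. \<forall>x\<in>{z-e..z+e}. \<forall>y\<in>{z-e..z+e}. p n x = 0 \<longrightarrow> p n y = 0 \<longrightarrow> x = y"
    using mono
  proof eventually_elim
    case (elim n)
    have sm: "s * p n a < s * p n b" if "a < b" "a \<in> {z-e..z+e}" "b \<in> {z-e..z+e}" for a b
    proof (rule DERIV_pos_imp_increasing[OF that(1)])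
      fix x assume "a \<le> x" "x \<le> b"
      hence "s * p' n x > 0" using elim that by auto
      moreover have "((\<lambda>x. s * p n x) has_real_derivative s * p' n x) (at x)"
        by (rule DERIV_cmult[OF dp])
      ultimately show "\<exists>y. ((\<lambda>x. s * p n x) has_real_derivative y) (at x) \<and> 0 < y" by blast
    qed
    show ?case
    proof (intro ballI impI)
      fix x y assume "x \<in> {z-e..z+e}" "y \<in> {z-e..z+e}" "p n x = 0" "p n y = 0"
      thus "x = y" using sm[of x y] sm[of y x] by (cases x y rule: linorder_cases) auto
    qed
  qed
  have ex: "\<forall>\<^sub>F n in sequentially. \<exists>x. z-\<delta> < x \<and> x < z+\<delta> \<and> p n x = 0" if \<delta>: "0 < \<delta>" "\<delta> \<le> e" for \<delta>
  proof -
    define \<eta> where "\<eta> = \<delta>/2"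
    have \<eta>: "0 < \<eta>" "\<eta> < \<delta>" "\<eta> \<le> e" using \<delta> by (auto simp: \<eta>_def)
    have L: "(\<lambda>n. s * p n x) \<longlonglongrightarrow> s * f x" if "x \<in> {z-e..z+e}" for x
      using tendsto_uniform_limitI[OF lim, of x] that sub by (intro tendsto_intros) auto
    have "s * f (z-\<eta>) < 0" "s * f (z+\<eta>) > 0"
      using smono[of "z-\<eta>" z] smono[of z "z+\<eta>"] \<eta> z by auto
    hence "\<forall>\<^sub>F n in sequentially. s * p n (z-\<eta>) < 0" "\<forall>\<^sub>F n in sequentially. s * p n (z+\<eta>) > 0"
      using order_tendstoD(2)[OF L[of "z-\<eta>"]] order_tendstoD(1)[OF L[of "z+\<eta>"]] \<eta> by auto
    thus ?thesis
    proof eventually_elim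
      case (elim n)
      have "continuous_on {z-\<eta>..z+\<eta>} (\<lambda>x. s * p n x)"
        using DERIV_isCont[OF dp] by (intro continuous_at_imp_continuous_on) auto
      then obtain x where "z-\<eta> \<le> x" "x \<le> z+\<eta>" "s * p n x = 0"
        using IVT'[of "\<lambda>x. s * p n x" "z-\<eta>" 0 "z+\<eta>"] elim \<eta> by auto
      thus ?case using \<eta> s by (intro exI[of _ x]) auto
    qed
  qed
  define \<xi> where "\<xi> = (\<lambda>n. SOME x. z-e < x \<and> x < z+e \<and> p n x = 0)"
  have \<xi>: "\<forall>\<^sub>F n in sequentially. {x. z-e < x \<and> x < z+e \<and> p n x = 0} = {\<xi> n}"
    using ex[OF e0 order_refl] inj
  proof eventually_elim
    case (elim n)
    have \<xi>n: "z-e < \<xi> n \<and> \<xi> n < z+e \<and> p n (\<xi> n) = 0" unfolding \<xi>_def using elim(1) by (rule someI_ex)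
    have "x = \<xi> n" if "z-e < x \<and> x < z+e \<and> p n x = 0" for x
      using elim(2)[rule_format, of x "\<xi> n"] that \<xi>n by simp
    thus ?case using \<xi>n by blast
  qed
  have "\<xi> \<longlonglongrightarrow> z"
  proof (rule tendstoI)
    fix \<epsilon> :: real assume \<epsilon>: "\<epsilon> > 0"
    define \<delta> where "\<delta> = min \<epsilon> e"
    have \<delta>: "0 < \<delta>" "\<delta> \<le> e" "\<delta> \<le> \<epsilon>" using \<epsilon> e0 by (auto simp: \<delta>_def)
    show "\<forall>\<^sub>F n in sequentially. dist (\<xi> n) z < \<epsilon>"
      using ex[OF \<delta>(1,2)] \<xi>
    proof eventually_elim
      case (elim n)
      then obtain x where x: "z-\<delta> < x" "x < z+\<delta>" "p n x = 0" by blast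
      hence "x \<in> {x. z-e < x \<and> x < z+e \<and> p n x = 0}" using \<delta> by auto
      hence "x = \<xi> n" using elim by auto
      thus ?case using x \<delta> by (auto simp: dist_real_def)
    qed
  qed
  hence "(\<lambda>n. \<phi> (\<xi> n)) \<longlonglongrightarrow> \<phi> z" using \<phi> by (rule isCont_tendsto_compose[rotated])
  moreover have "\<forall>\<^sub>F n in sequentially. \<phi> (\<xi> n) = (\<Sum>x\<in>{x. z-e < x \<and> x < z+e \<and> p n x = 0}. \<phi> x)"
    using \<xi> by eventually_elim simp
  ultimately have "(\<lambda>n. \<Sum>x\<in>{x. z-e < x \<and> x < z+e \<and> p n x = 0}. \<phi> x) \<longlonglongrightarrow> \<phi> z"
    by (rule Lim_transform_eventually)
  thus ?thesis using e0 e(2) sub uniq by (intro exI[of _ e] conjI) auto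
qed

lemma finite_simple_zeros:
  fixes f f' :: "real \<Rightarrow> real"
  assumes df: "\<And>x. x \<in> {A..B} \<Longrightarrow> (f has_real_derivative f' x) (at x)"
    and simple: "\<And>x. x \<in> {A..B} \<Longrightarrow> f x = 0 \<Longrightarrow> f' x \<noteq> 0"
  shows "finite {x\<in>{A..B}. f x = 0}"
proof (rule ccontr)
  define Z where "Z = {x\<in>{A..B}. f x = 0}"
  assume "infinite {x\<in>{A..B}. f x = 0}"
  then obtain x where x: "x \<in> {A..B}" "x islimpt Z"
    using compact_Icc[of A B] unfolding compact_eq_Bolzano_Weierstrass Z_def by blast
  have "isCont f x" using DERIV_isCont[OF df[OF x(1)]] .
  hence lim: "(f \<longlongrightarrow> f x) (at x within Z)" 
    using continuous_at_imp_continuous_at_within continuous_within by blast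
  have nt: "\<not> trivial_limit (at x within Z)" using x(2) trivial_limit_within by blast
  have ev: "eventually (\<lambda>y. f y = 0) (at x within Z)"
    unfolding eventually_at_filter Z_def by simp
  have fx: "f x = 0"
    using tendsto_unique[OF nt lim tendsto_eventually[OF ev]] .
  have "((\<lambda>y. (f y - f x) / (y - x)) \<longlongrightarrow> f' x) (at x)"
    using df[OF x(1)] unfolding has_field_derivative_iff .
  hence "((\<lambda>y. (f y - f x) / (y - x)) \<longlongrightarrow> f' x) (at x within Z)"
    by (rule tendsto_within_subset) auto
  moreover have "eventually (\<lambda>y. (f y - f x) / (y - x) = 0) (at x within Z)"
    using ev by eventually_elim (simp add: fx)
  ultimately have "f' x = 0" by (intro tendsto_unique[OF nt]) (auto intro: tendsto_eventually)
  thus False using simple[OF x(1) fx] by simp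
qed

text \<open>
  A real version of Hurwitz's theorem.  Only at a multiple zero of the limit can the approximants have
  no real zero, or more than one, nearby; simplicity of the zeros of \<open>f\<close> replaces the argument
  principle.
\<close>
lemma real_Hurwitz_sum:
  fixes f f' :: "real \<Rightarrow> real" and p p' :: "nat \<Rightarrow> real \<Rightarrow> real"
  assumes lim: "uniform_limit {A..B} p f sequentially"
    and lim': "uniform_limit {A..B} p' f' sequentially"
    and dp: "\<And>n x. (p n has_real_derivative p' n x) (at x)"
    and df: "\<And>x. (f has_real_derivative f' x) (at x)"
    and cf': "continuous_on {A..B} f'"
    and ends: "f A \<noteq> 0" "f B \<noteq> 0"
    and simple: "\<And>x. x \<in> {A..B} \<Longrightarrow> f x = 0 \<Longrightarrow> f' x \<noteq> 0"
    and \<phi>: "\<And>x. x \<in> {A..B} \<Longrightarrow> isCont \<phi> x"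
    and fin: "\<And>n. finite {x\<in>{A..B}. p n x = 0}"
  shows "(\<lambda>n. \<Sum>x\<in>{x\<in>{A..B}. p n x = 0}. \<phi> x) \<longlonglongrightarrow> (\<Sum>x\<in>{x\<in>{A..B}. f x = 0}. (\<phi> x :: real))"
proof -
  define Z where "Z = {x\<in>{A..B}. f x = 0}"
  define P where "P = (\<lambda>n. {x\<in>{A..B}. p n x = 0})"
  have finZ: "finite Z" unfolding Z_def by (rule finite_simple_zeros[OF df simple])
  have Zin: "A < z" "z < B" "f z = 0" "f' z \<noteq> 0" "isCont \<phi> z" if "z \<in> Z" for z
    using that ends simple \<phi> by (auto simp: Z_def order.strict_iff_order)
  have "\<exists>e. 0 < e \<and> {z-e..z+e} \<subseteq> {A..B} \<and> (\<forall>y\<in>Z. y \<noteq> z \<longrightarrow> 2 * e < dist z y) \<and>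
     (\<lambda>n. \<Sum>x\<in>{x. z-e < x \<and> x < z+e \<and> p n x = 0}. \<phi> x) \<longlonglongrightarrow> \<phi> z" if z: "z \<in> Z" for z
  proof -
    obtain d where d: "d > 0" "\<And>y. y \<in> Z \<Longrightarrow> y \<noteq> z \<Longrightarrow> d \<le> dist z y"
      using finite_set_avoid[OF finZ] by blast
    from real_Hurwitz_local[OF lim lim' dp df cf' Zin[OF z], of "d/2"] d(1)
    obtain e where e: "0 < e" "e < d/2" "{z-e..z+e} \<subseteq> {A..B}"
      "(\<lambda>n. \<Sum>x\<in>{x. z-e < x \<and> x < z+e \<and> p n x = 0}. \<phi> x) \<longlonglongrightarrow> \<phi> z" by auto
    show ?thesis using e d(2) by (intro exI[of _ e]) force
  qed
  then have "\<forall>z\<in>Z. \<exists>e. 0 < e \<and> {z-e..z+e} \<subseteq> {A..B} \<and> (\<forall>y\<in>Z. y \<noteq> z \<longrightarrow> 2 * e < dist z y) \<and>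
     (\<lambda>n. \<Sum>x\<in>{x. z-e < x \<and> x < z+e \<and> p n x = 0}. \<phi> x) \<longlonglongrightarrow> \<phi> z" by blast
  from bchoice[OF this] obtain e where e: "\<And>z. z \<in> Z \<Longrightarrow> 0 < e z"
      "\<And>z. z \<in> Z \<Longrightarrow> {z - e z..z + e z} \<subseteq> {A..B}"
      "\<And>z y. z \<in> Z \<Longrightarrow> y \<in> Z \<Longrightarrow> y \<noteq> z \<Longrightarrow> 2 * e z < dist z y"
      "\<And>z. z \<in> Z \<Longrightarrow> (\<lambda>n. \<Sum>x\<in>{x. z - e z < x \<and> x < z + e z \<and> p n x = 0}. \<phi> x) \<longlonglongrightarrow> \<phi> z"
    by auto
  \<comment> \<open>off these intervals the limit is bounded away from zero, so approximants have no zeros there\<close>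
  define U where "U = (\<lambda>z. {z - e z<..<z + e z})"
  define K where "K = {A..B} - (\<Union>z\<in>Z. U z)"
  have "compact K" unfolding K_def U_def by (intro compact_diff) auto
  have contf: "continuous_on K f" using DERIV_isCont[OF df] by (intro continuous_at_imp_continuous_on) auto
  have fK: "f x \<noteq> 0" if "x \<in> K" for x
    using that e(1) unfolding K_def U_def Z_def by force
  have "\<exists>c>0. \<forall>x\<in>K. \<bar>f x\<bar> \<ge> c"
  proof (cases "K = {}")
    case False
    then obtain x0 where x0: "x0 \<in> K" "\<And>x. x \<in> K \<Longrightarrow> \<bar>f x0\<bar> \<le> \<bar>f x\<bar>"
      using continuous_attains_inf[OF \<open>compact K\<close> False, of "\<lambda>x. \<bar>f x\<bar>"] contf
      by (auto intro: continuous_intros)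
    thus ?thesis using fK[OF x0(1)] by (intro exI[of _ "\<bar>f x0\<bar>"]) auto
  qed (auto intro: exI[of _ 1])
  then obtain c where c: "c > 0" "\<And>x. x \<in> K \<Longrightarrow> \<bar>f x\<bar> \<ge> c" by blast
  have noK: "\<forall>\<^sub>F n in sequentially. \<forall>x\<in>K. p n x \<noteq> 0"
    using uniform_limitD[OF lim c(1)]
  proof eventually_elim
    case (elim n)
    show ?case
    proof
      fix x assume x: "x \<in> K"
      hence "dist (p n x) (f x) < c" using elim by (auto simp: K_def)
      thus "p n x \<noteq> 0" using c(2)[OF x] by (auto simp: dist_real_def)
    qed
  qed
  have split: "\<forall>\<^sub>F n in sequentially. (\<Sum>z\<in>Z. \<Sum>x\<in>{x. z - e z < x \<and> x < z + e z \<and> p n x = 0}. \<phi> x) = (\<Sum>x\<in>P n. \<phi> x)"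
    using noK
  proof eventually_elim
    case (elim n)
    have sub: "{x. z - e z < x \<and> x < z + e z \<and> p n x = 0} \<subseteq> P n" if "z \<in> Z" for z
      using e(2)[OF that] by (auto simp: P_def)
    have "P n = (\<Union>z\<in>Z. {x. z - e z < x \<and> x < z + e z \<and> p n x = 0})"
    proof (intro equalityI subsetI)
      fix x assume x: "x \<in> P n"
      hence "x \<notin> K" using elim by (auto simp: P_def)
      thus "x \<in> (\<Union>z\<in>Z. {x. z - e z < x \<and> x < z + e z \<and> p n x = 0})"
        using x by (auto simp: K_def U_def P_def)
    qed (use sub in blast)
    moreover have "(\<Sum>x\<in>(\<Union>z\<in>Z. {x. z - e z < x \<and> x < z + e z \<and> p n x = 0}). \<phi> x) =
      (\<Sum>z\<in>Z. \<Sum>x\<in>{x. z - e z < x \<and> x < z + e z \<and> p n x = 0}. \<phi> x)"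
    proof (rule sum.UNION_disjoint[OF finZ])
      show "\<forall>z\<in>Z. finite {x. z - e z < x \<and> x < z + e z \<and> p n x = 0}"
        using sub fin finite_subset unfolding P_def by blast
      show "\<forall>z\<in>Z. \<forall>y\<in>Z. z \<noteq> y \<longrightarrow> {x. z - e z < x \<and> x < z + e z \<and> p n x = 0} \<inter> {x. y - e y < x \<and> x < y + e y \<and> p n x = 0} = {}"
      proof (intro ballI impI)
        fix z y assume "z \<in> Z" "y \<in> Z" "z \<noteq> y"
        hence "2 * e z < \<bar>z - y\<bar>" "2 * e y < \<bar>z - y\<bar>"
          using e(3)[of z y] e(3)[of y z] by (auto simp: dist_real_def abs_minus_commute)
        thus "{x. z - e z < x \<and> x < z + e z \<and> p n x = 0} \<inter> {x. y - e y < x \<and> x < y + e y \<and> p n x = 0} = {}"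
          by auto
      qed
    qed
    ultimately show ?case by simp
  qed
  have "(\<lambda>n. \<Sum>z\<in>Z. \<Sum>x\<in>{x. z - e z < x \<and> x < z + e z \<and> p n x = 0}. \<phi> x) \<longlonglongrightarrow> (\<Sum>z\<in>Z. \<phi> z)"
    by (intro tendsto_sum e(4))
  hence "(\<lambda>n. \<Sum>x\<in>P n. \<phi> x) \<longlonglongrightarrow> (\<Sum>z\<in>Z. \<phi> z)"
    using split by (rule Lim_transform_eventually)
  thus ?thesis by (simp add: Z_def P_def)
qed

lemma uniform_limit_poly_coeff:
  fixes p :: "nat \<Rightarrow> real poly"
  assumes lim: "\<And>k. (\<lambda>n. coeff (p n) k) \<longlonglongrightarrow> b k"
    and bound: "\<And>n k. \<bar>coeff (p n) k\<bar> \<le> \<bar>b k\<bar>"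
    and summ: "\<And>z. summable (\<lambda>k. b k * z ^ k)"
  shows "uniform_limit {-R..R} (\<lambda>n. poly (p n)) (\<lambda>z. \<Sum>k. b k * z ^ k) sequentially"
proof -
  have "summable (\<lambda>k. norm (b k * \<bar>R\<bar> ^ k))"
    by (rule powser_insidea[OF summ[of "\<bar>R\<bar> + 1"]]) auto
  hence sb: "summable (\<lambda>k. \<bar>b k\<bar> * \<bar>R\<bar> ^ k)" by (simp add: abs_mult power_abs)
  define e where "e = (\<lambda>k n. \<bar>coeff (p n) k - b k\<bar> * \<bar>R\<bar> ^ k)"
  have ebound: "e k n \<le> 2 * (\<bar>b k\<bar> * \<bar>R\<bar> ^ k)" for k n
  proof -
    have "\<bar>coeff (p n) k - b k\<bar> \<le> 2 * \<bar>b k\<bar>" using bound[of n k] by linarith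
    hence "\<bar>coeff (p n) k - b k\<bar> * \<bar>R\<bar> ^ k \<le> 2 * \<bar>b k\<bar> * \<bar>R\<bar> ^ k" by (rule mult_right_mono) simp
    thus ?thesis by (simp add: e_def)
  qed
  have e0: "e k n \<ge> 0" for k n by (simp add: e_def)
  have se: "summable (\<lambda>k. e k n)" for n
    by (rule summable_comparison_test'[OF summable_mult[OF sb, of 2], of 0]) (use ebound e0 in auto)
  have "eventually (\<lambda>n. summable (\<lambda>k. norm (e k n))) sequentially \<and>
           summable (\<lambda>k. norm (0::real)) \<and>
           ((\<lambda>n. \<Sum>k. e k n) \<longlonglongrightarrow> (\<Sum>k. 0))"
  proof (rule tannerys_theorem)
    show "(\<lambda>n. e k n) \<longlonglongrightarrow> 0" for k
      unfolding e_def using lim[of k]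
      by (intro tendsto_mult_left_zero tendsto_rabs_zero LIM_zero)
    show "\<forall>\<^sub>F (k,n) in sequentially \<times>\<^sub>F sequentially. norm (e k n) \<le> 2 * (\<bar>b k\<bar> * \<bar>R\<bar> ^ k)"
      using ebound e0 by (intro always_eventually) auto
    show "summable (\<lambda>k. 2 * (\<bar>b k\<bar> * \<bar>R\<bar> ^ k))" by (rule summable_mult[OF sb])
  qed auto
  hence E: "(\<lambda>n. \<Sum>k. e k n) \<longlonglongrightarrow> 0" by simp
  have diff: "dist (poly (p n) z) (\<Sum>k. b k * z ^ k) \<le> (\<Sum>k. e k n)" if z: "z \<in> {-R..R}" for n z
  proof -
    have fs: "(\<lambda>k. coeff (p n) k * z ^ k) sums poly (p n) z"
      unfolding poly_altdef by (rule sums_finite) (auto simp: coeff_eq_0)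
    have "(\<lambda>k. coeff (p n) k * z ^ k - b k * z ^ k) sums (poly (p n) z - (\<Sum>k. b k * z ^ k))"
      by (intro sums_diff fs summable_sums summ)
    hence eq: "(\<lambda>k. (coeff (p n) k - b k) * z ^ k) sums (poly (p n) z - (\<Sum>k. b k * z ^ k))"
      by (simp add: algebra_simps)
    have le: "norm ((coeff (p n) k - b k) * z ^ k) \<le> e k n" for k
    proof -
      have "\<bar>z\<bar> ^ k \<le> \<bar>R\<bar> ^ k" using z by (intro power_mono) auto
      thus ?thesis by (simp add: e_def abs_mult power_abs mult_left_mono)
    qed
    have "norm (\<Sum>k. (coeff (p n) k - b k) * z ^ k) \<le> (\<Sum>k. e k n)"
      by (rule norm_suminf_le[OF le se])
    thus ?thesis using sums_unique[OF eq] by (simp add: dist_real_def)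
  qed
  show ?thesis
  proof (rule uniform_limitI)
    fix \<epsilon> :: real assume "\<epsilon> > 0"
    hence "\<forall>\<^sub>F n in sequentially. (\<Sum>k. e k n) < \<epsilon>" using order_tendstoD(2)[OF E] by blast
    thus "\<forall>\<^sub>F n in sequentially. \<forall>x\<in>{-R..R}. dist (poly (p n) x) (\<Sum>k. b k * x ^ k) < \<epsilon>"
    proof eventually_elim
      case (elim n)
      show ?case using diff[of _ n] elim by (meson le_less_trans)
    qed
  qed
qed

lemma uniform_limit_pderiv_coeff:
  fixes p :: "nat \<Rightarrow> real poly"
  assumes lim: "\<And>k. (\<lambda>n. coeff (p n) k) \<longlonglongrightarrow> b k"
    and bound: "\<And>n k. \<bar>coeff (p n) k\<bar> \<le> \<bar>b k\<bar>"
  shows "\<And>k. (\<lambda>n. coeff (pderiv (p n)) k) \<longlonglongrightarrow> diffs b k"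
    and "\<And>n k. \<bar>coeff (pderiv (p n)) k\<bar> \<le> \<bar>diffs b k\<bar>"
  unfolding coeff_pderiv diffs_def 
  using lim bound by (auto intro!: tendsto_intros mult_left_mono simp: abs_mult simp del: of_nat_Suc)

lemma poly_eq_prod_roots:
  fixes p :: "'a :: idom poly"
  assumes "finite S" "card S = degree p" "\<And>x. x \<in> S \<Longrightarrow> poly p x = 0"
  obtains c where "p = smult c (\<Prod>x\<in>S. [:-x, 1:])"
proof -
  have *: "\<exists>q. p = q * (\<Prod>x\<in>S. [:-x, 1:])"
    using assms(1,3)
  proof (induction S rule: finite_induct)
    case (insert a S)
    then obtain q where q: "p = q * (\<Prod>x\<in>S. [:-x, 1:])" by auto
    have "poly p a = 0" using insert by auto
    moreover have "poly (\<Prod>x\<in>S. [:-x, 1:]) a \<noteq> 0" using insert by (auto simp: poly_prod)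
    ultimately have "poly q a = 0" using q by simp
    then obtain r where "q = [:-a, 1:] * r" unfolding poly_eq_0_iff_dvd dvd_def by blast
    hence "p = r * ([:-a, 1:] * (\<Prod>x\<in>S. [:-x, 1:]))" using q by (simp only: mult_ac)
    hence "p = r * (\<Prod>x\<in>insert a S. [:-x, 1:])" using insert by (subst prod.insert) auto
    thus ?case by blast
  qed auto
  then obtain q where q: "p = q * (\<Prod>x\<in>S. [:-x, 1:])" by blast
  define P where "P = (\<Prod>x\<in>S. [:-x, 1:])"
  have P: "P \<noteq> 0" "degree P = card S" unfolding P_def using assms(1)
    by (auto simp: degree_prod_eq_sum_degree)
  show ?thesis
  proof (cases "q = 0")
    case True thus ?thesis using that[of 0] q by simp
  next
    case False
    hence "degree p = degree q + card S" using q P by (simp add: P_def[symmetric] degree_mult_eq)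
    hence "degree q = 0" using assms by simp
    then obtain c where "q = [:c:]" by (auto elim: degree_eq_zeroE)
    thus ?thesis using that[of c] q by simp
  qed
qed

text \<open>
  The second logarithmic derivative is preferred to the first because its partial fraction expansion
  converges fast enough to survive the passage from polynomials to entire functions.
\<close>
lemma log_deriv_prod_roots:
  fixes z :: real
  assumes fin: "finite S" and p: "p = smult c (\<Prod>x\<in>S. [:-x, 1:])" and c: "c \<noteq> 0" and z: "z \<notin> S"
  shows "poly p z \<noteq> 0"
    and "poly (pderiv p) z / poly p z = (\<Sum>x\<in>S. 1 / (z - x))"
    and "(poly (pderiv p) z / poly p z)\<^sup>2 - poly (pderiv (pderiv p)) z / poly p z = (\<Sum>x\<in>S. 1 / (z - x)\<^sup>2)"
proof -
  have nz: "poly p u \<noteq> 0" if "u \<notin> S" for u using that fin c unfolding p by (auto simp: poly_prod)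
  show "poly p z \<noteq> 0" by (rule nz[OF z])
  have ld: "poly (pderiv p) u / poly p u = (\<Sum>x\<in>S. 1 / (u - x))" if u: "u \<notin> S" for u
  proof -
    have "((\<lambda>w. c * (\<Prod>x\<in>S. w - x)) has_real_derivative c * ((\<Prod>x\<in>S. u - x) * (\<Sum>x\<in>S. 1 / (u - x)))) (at u)"
      by (rule DERIV_cmult, rule has_field_derivative_prod') (use u in \<open>auto intro!: derivative_eq_intros\<close>)
    moreover have "poly p = (\<lambda>w. c * (\<Prod>x\<in>S. w - x))" unfolding p by (auto simp: poly_prod)
    ultimately have "poly (pderiv p) u = poly p u * (\<Sum>x\<in>S. 1 / (u - x))"
      using DERIV_unique[OF poly_DERIV[of p u]] by simp
    thus ?thesis using nz[OF u] by simp
  qed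
  show "poly (pderiv p) z / poly p z = (\<Sum>x\<in>S. 1 / (z - x))" by (rule ld[OF z])
  define d where "d = (poly (pderiv (pderiv p)) z * poly p z - poly (pderiv p) z * poly (pderiv p) z) / (poly p z * poly p z)"
  have dq: "((\<lambda>u. poly (pderiv p) u / poly p u) has_real_derivative d) (at z)"
    unfolding d_def by (rule DERIV_divide[OF poly_DERIV poly_DERIV nz[OF z]])
  have ev: "\<forall>\<^sub>F u in nhds z. poly (pderiv p) u / poly p u = (\<Sum>x\<in>S. 1 / (u - x))"
  proof (rule eventually_mono[OF eventually_nhds_in_open[of "- S" z]])
    show "open (- S)" using fin by (simp add: open_Compl finite_imp_closed)
  qed (use z ld in auto)
  have "((\<lambda>u. \<Sum>x\<in>S. 1 / (u - x)) has_real_derivative d) (at z)"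
    by (rule iffD1[OF DERIV_cong_ev[OF refl ev refl] dq])
  moreover have "((\<lambda>u. \<Sum>x\<in>S. 1 / (u - x)) has_real_derivative (\<Sum>x\<in>S. - (1 / (z - x)\<^sup>2))) (at z)"
    by (rule DERIV_sum) (use z in \<open>auto intro!: derivative_eq_intros simp: power2_eq_square\<close>)
  ultimately have "d = - (\<Sum>x\<in>S. 1 / (z - x)\<^sup>2)" using DERIV_unique by (simp add: sum_negf)
  moreover have "d = poly (pderiv (pderiv p)) z / poly p z - (poly (pderiv p) z / poly p z)\<^sup>2"
    using nz[OF z] unfolding d_def by (simp add: field_simps power2_eq_square)
  ultimately show "(poly (pderiv p) z / poly p z)\<^sup>2 - poly (pderiv (pderiv p)) z / poly p z = (\<Sum>x\<in>S. 1 / (z - x)\<^sup>2)"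
    by simp
qed

lemma choose_div_power_eq:
  fixes N :: nat assumes "N > 0"
  shows "real (N choose k) / real N ^ k = (\<Prod>i<k. 1 - real i / real N) / fact k"
proof -
  have "real (N choose k) = (\<Prod>i<k. real N - real i) / fact k"
    by (simp add: binomial_gbinomial gbinomial_prod_rev lessThan_atLeast0)
  moreover have "(\<Prod>i<k. 1 - real i / real N) * real N ^ k = (\<Prod>i<k. real N - real i)"
  proof -
    have "(\<Prod>i<k. 1 - real i / real N) * (\<Prod>i<k. real N) = (\<Prod>i<k. (1 - real i / real N) * real N)"
      by (simp only: prod.distrib)
    also have "\<dots> = (\<Prod>i<k. real N - real i)" using assms by (intro prod.cong) (auto simp: field_simps)
    finally show ?thesis by simp
  qed
  ultimately show ?thesis using assms by (simp add: field_simps)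
qed

lemma choose_div_power_tendsto:
  "(\<lambda>n. real (Suc n choose k) / real (Suc n) ^ k) \<longlonglongrightarrow> 1 / fact k"
proof -
  have "(\<lambda>n. real i / real (Suc n)) \<longlonglongrightarrow> 0" for i
    using LIMSEQ_Suc[OF lim_const_over_n[of "real i"]] by simp
  hence "(\<lambda>n. (\<Prod>i<k. 1 - real i / real (Suc n)) / fact k) \<longlonglongrightarrow> (\<Prod>i<k. 1 - 0) / fact k"
    by (intro tendsto_intros) auto
  thus ?thesis by (subst choose_div_power_eq) auto
qed

lemma choose_div_power_le:
  "real (Suc n choose k) / real (Suc n) ^ k \<le> 1 / fact k"
proof (cases "k \<le> Suc n")
  case True
  have "(\<Prod>i<k. 1 - real i / real (Suc n)) \<le> 1"
    using True by (intro prod_le_1) (auto simp del: of_nat_Suc)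
  thus ?thesis by (subst choose_div_power_eq) (auto intro: divide_right_mono)
qed (simp add: binomial_eq_0)

section \<open>From Laguerre polynomials to the Bessel series\<close>

text \<open>
  The degree starts at \<open>1\<close>, so that the scaling factor is defined.
\<close>
abbreviation scaled_laguerre :: "real \<Rightarrow> nat \<Rightarrow> real poly" where
  "scaled_laguerre m n \<equiv> laguerre m (1 / real (Suc n)) (Suc n)"

lemma coeff_scaled_laguerre:
  "coeff (scaled_laguerre m n) k = (real (Suc n choose k) / real (Suc n) ^ k) * ((-1) ^ k * rGamma (m + real k + 1))"
  unfolding coeff_laguerre power_minus[of "1 / real (Suc n)"] power_one_over by (simp del: of_nat_Suc)

definition alt_coeff :: "real \<Rightarrow> nat \<Rightarrow> real" where
  "alt_coeff m k = (-1) ^ k * bessel_coeff m k"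

lemma alt_coeff_series:
  "alt_coeff m k * x ^ k = bessel_coeff m k * (-x) ^ k"
  by (simp add: alt_coeff_def power_minus[of x])

lemma diffs_alt_coeff: "diffs (alt_coeff m) = (\<lambda>k. - alt_coeff (m + 1) k)"
  by (rule ext) (simp add: diffs_def alt_coeff_def flip: diffs_bessel_coeff)

lemma diffs_diffs_alt_coeff: "diffs (diffs (alt_coeff m)) = alt_coeff (m + 2)"
proof
  fix k
  have "diffs (diffs (alt_coeff m)) k = - diffs (alt_coeff (m + 1)) k"
    unfolding diffs_alt_coeff[of m] by (simp add: diffs_def)
  thus "diffs (diffs (alt_coeff m)) k = alt_coeff (m + 2) k"
    by (simp add: diffs_alt_coeff add.assoc)
qed

lemma summable_alt_coeff: "summable (\<lambda>k. alt_coeff m k * x ^ k)"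
  unfolding alt_coeff_series by (rule summable_bessel_coeff)

lemma suminf_alt_coeff: "(\<Sum>k. alt_coeff m k * x ^ k) = bessel_series m (-x)"
  unfolding alt_coeff_series bessel_series_def ..

text \<open>
  The classical limit of Laguerre polynomials to Bessel functions, together with its first two
  derivatives: the coefficients converge and are dominated by those of the limit because
  \<open>(N choose k) / N^k\<close> tends to \<open>1 / fact k\<close> from below.
\<close>
lemma
  shows scaled_laguerre_uniform_limit:
      "uniform_limit {-R..R} (\<lambda>n. poly (scaled_laguerre m n)) (\<lambda>x. bessel_series m (-x)) sequentially"
    and pderiv_scaled_laguerre_uniform_limit:
      "uniform_limit {-R..R} (\<lambda>n. poly (pderiv (scaled_laguerre m n))) (\<lambda>x. - bessel_series (m + 1) (-x)) sequentially"
    and pderiv2_scaled_laguerre_uniform_limit: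
      "uniform_limit {-R..R} (\<lambda>n. poly (pderiv (pderiv (scaled_laguerre m n)))) (\<lambda>x. bessel_series (m + 2) (-x)) sequentially"
proof -
  let ?b = "alt_coeff m"
  have L0: "(\<lambda>n. coeff (scaled_laguerre m n) k) \<longlonglongrightarrow> ?b k" for k
    unfolding coeff_scaled_laguerre
    using tendsto_mult_right[OF choose_div_power_tendsto[of k], of "(-1) ^ k * rGamma (m + real k + 1)"]
    by (simp add: alt_coeff_def bessel_coeff_def)
  have B0: "\<bar>coeff (scaled_laguerre m n) k\<bar> \<le> \<bar>?b k\<bar>" for n k
    using mult_right_mono[OF choose_div_power_le[of n k], of "\<bar>rGamma (m + real k + 1)\<bar>"]
    unfolding coeff_scaled_laguerre by (simp add: abs_mult alt_coeff_def bessel_coeff_def del: of_nat_Suc)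
  note L1 = uniform_limit_pderiv_coeff(1)[OF L0 B0] and B1 = uniform_limit_pderiv_coeff(2)[OF L0 B0]
  note L2 = uniform_limit_pderiv_coeff(1)[OF L1 B1] and B2 = uniform_limit_pderiv_coeff(2)[OF L1 B1]
  show "uniform_limit {-R..R} (\<lambda>n. poly (scaled_laguerre m n)) (\<lambda>x. bessel_series m (-x)) sequentially"
    using uniform_limit_poly_coeff[OF L0 B0 summable_alt_coeff] by (simp add: suminf_alt_coeff)
  have s: "summable (\<lambda>k. diffs ?b k * x ^ k)" for x
    using summable_minus[OF summable_alt_coeff] by (simp add: diffs_alt_coeff)
  have "(\<Sum>k. diffs ?b k * x ^ k) = - bessel_series (m + 1) (-x)" for x
    using suminf_minus[OF summable_alt_coeff[of "m+1" x]] by (simp add: diffs_alt_coeff suminf_alt_coeff)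
  thus "uniform_limit {-R..R} (\<lambda>n. poly (pderiv (scaled_laguerre m n))) (\<lambda>x. - bessel_series (m + 1) (-x)) sequentially"
    using uniform_limit_poly_coeff[OF L1 B1 s] by simp
  show "uniform_limit {-R..R} (\<lambda>n. poly (pderiv (pderiv (scaled_laguerre m n)))) (\<lambda>x. bessel_series (m + 2) (-x)) sequentially"
    using uniform_limit_poly_coeff[OF L2 B2] summable_alt_coeff by (simp add: diffs_diffs_alt_coeff suminf_alt_coeff)
qed

definition scaled_laguerre_zeros :: "real \<Rightarrow> nat \<Rightarrow> real set" where
  "scaled_laguerre_zeros m n = {x. poly (scaled_laguerre m n) x = 0}"

lemma
  assumes m: "m > -1"
  shows finite_scaled_laguerre_zeros: "finite (scaled_laguerre_zeros m n)"
    and scaled_laguerre_zeros_pos: "x \<in> scaled_laguerre_zeros m n \<Longrightarrow> x > 0"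
    and scaled_laguerre_factor: "\<exists>c. c \<noteq> 0 \<and> scaled_laguerre m n = smult c (\<Prod>x\<in>scaled_laguerre_zeros m n. [:-x, 1:])"
proof -
  obtain S where S: "finite S" "card S = Suc n" "\<And>x. x \<in> S \<Longrightarrow> x > 0 \<and> poly (scaled_laguerre m n) x = 0"
    using laguerre_roots[OF m, of "1 / real (Suc n)" "Suc n"] by auto
  have deg: "degree (scaled_laguerre m n) = Suc n" by (rule degree_laguerre[OF m]) simp
  obtain c where c: "scaled_laguerre m n = smult c (\<Prod>x\<in>S. [:-x, 1:])"
    using poly_eq_prod_roots[OF S(1), of "scaled_laguerre m n"] S deg by auto
  have c0: "c \<noteq> 0"
  proof
    assume "c = 0"
    hence "scaled_laguerre m n = 0" by (subst c) simp
    thus False using deg by simp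
  qed
  have "poly (scaled_laguerre m n) x = 0 \<longleftrightarrow> x \<in> S" for x
    using c0 S(1) unfolding c by (auto simp: poly_prod)
  hence eq: "scaled_laguerre_zeros m n = S" by (auto simp: scaled_laguerre_zeros_def)
  show "finite (scaled_laguerre_zeros m n)" using S eq by simp
  show "x \<in> scaled_laguerre_zeros m n \<Longrightarrow> x > 0" using S eq by simp
  show "\<exists>c. c \<noteq> 0 \<and> scaled_laguerre m n = smult c (\<Prod>x\<in>scaled_laguerre_zeros m n. [:-x, 1:])" using c c0 eq by blast
qed

text \<open>
  The first logarithmic derivative at \<open>0\<close>, read off from two coefficients.  That the value does not
  depend on \<open>n\<close> is what gives a uniform bound on the contribution of the large zeros.
\<close>
lemma sum_inverse_scaled_laguerre_zeros:
  assumes m: "m > -1"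
  shows "(\<Sum>x\<in>scaled_laguerre_zeros m n. 1 / x) = 1 / (m + 1)"
proof -
  obtain c where c: "c \<noteq> 0" "scaled_laguerre m n = smult c (\<Prod>x\<in>scaled_laguerre_zeros m n. [:-x, 1:])"
    using scaled_laguerre_factor[OF m] by blast
  have "0 \<notin> scaled_laguerre_zeros m n" using scaled_laguerre_zeros_pos[OF m, of 0 n] by blast
  from log_deriv_prod_roots(2)[OF finite_scaled_laguerre_zeros[OF m] c(2,1) this]
  have "poly (pderiv (scaled_laguerre m n)) 0 / poly (scaled_laguerre m n) 0 = - (\<Sum>x\<in>scaled_laguerre_zeros m n. 1 / x)"
    by (simp add: sum_negf)
  moreover have "poly (pderiv (scaled_laguerre m n)) 0 = - rGamma (m + 2)"
    unfolding poly_0_coeff_0 coeff_pderiv coeff_scaled_laguerre by (simp add: add.commute)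
  moreover have "poly (scaled_laguerre m n) 0 = (m + 1) * rGamma (m + 2)"
    unfolding poly_0_coeff_0 coeff_scaled_laguerre using rGamma_plus1[of "m + 1"] by (simp add: add.assoc)
  moreover have "rGamma (m + 2) \<noteq> 0"
    using bessel_series_0_pos[of "m+1"] m by (simp add: bessel_series_0 add.assoc)
  ultimately have "rGamma (m + 2) / ((m + 1) * rGamma (m + 2)) = (\<Sum>x\<in>scaled_laguerre_zeros m n. 1 / x)"
    by simp
  thus ?thesis using \<open>rGamma (m + 2) \<noteq> 0\<close> by simp
qed

section \<open>The partial fraction expansion\<close>
definition bessel_zeros :: "real \<Rightarrow> real set" where
  "bessel_zeros m = {x. x > 0 \<and> bessel_series m (-x) = 0}"

text \<open>
  This is \<open>- (ln F)''\<close> for \<open>F = bessel_series m\<close>, with the derivatives expressed by shifted orders.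
\<close>
definition neg_log_deriv2 :: "real \<Rightarrow> real \<Rightarrow> real" where
  "neg_log_deriv2 m t = (bessel_series (m + 1) t / bessel_series m t)\<^sup>2 - bessel_series (m + 2) t / bessel_series m t"

lemma bessel_zeros_atMost:
  assumes "m > -1"
  shows "{x\<in>bessel_zeros m. x \<le> R} = {x\<in>{0..R}. bessel_series m (-x) = 0}"
  using bessel_series_0_pos[OF assms] by (auto simp: bessel_zeros_def order.strict_iff_order)

lemma finite_bessel_zeros_atMost:
  assumes m: "m > -1"
  shows "finite {x\<in>bessel_zeros m. x \<le> R}"
  unfolding bessel_zeros_atMost[OF m]
proof (rule finite_simple_zeros[where f' = "\<lambda>x. - bessel_series (m + 1) (-x)"])
  fix x assume "x \<in> {0..R}" "bessel_series m (-x) = 0"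
  hence "x > 0" using bessel_series_0_pos[OF m] by (auto simp: order.strict_iff_order)
  thus "- bessel_series (m + 1) (-x) \<noteq> 0"
    using bessel_series_zero_simple[OF m] \<open>bessel_series m (-x) = 0\<close> by simp
qed (auto intro!: derivative_eq_intros)

text \<open>
  For the polynomials the expansion is exact, and the zeros beyond \<open>R\<close> contribute at most
  \<open>(1 / R) (\<Sum>x. 1 / x) = 1 / (R (m + 1))\<close>.  Both facts pass to the limit, the finitely many zeros below
  \<open>R\<close> converging by the real Hurwitz theorem; the cut-off must not be a zero itself.
\<close>
lemma bessel_zeros_partial_sum:
  assumes m: "m > -1" and t: "t > 0" and R: "R > 0" "bessel_series m (-R) \<noteq> 0"
  shows "(\<Sum>x\<in>{x\<in>bessel_zeros m. x \<le> R}. 1 / (t + x)\<^sup>2) \<le> neg_log_deriv2 m t"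
    and "neg_log_deriv2 m t \<le> (\<Sum>x\<in>{x\<in>bessel_zeros m. x \<le> R}. 1 / (t + x)\<^sup>2) + 1 / (R * (m + 1))"
proof -
  define s where "s = (\<lambda>n. \<Sum>x\<in>{x\<in>{0..R}. poly (scaled_laguerre m n) x = 0}. 1 / (t + x)\<^sup>2)"
  define a where "a = (\<lambda>n. (poly (pderiv (scaled_laguerre m n)) (-t) / poly (scaled_laguerre m n) (-t))\<^sup>2 - poly (pderiv (pderiv (scaled_laguerre m n))) (-t) / poly (scaled_laguerre m n) (-t))"
  have s_lim: "s \<longlonglongrightarrow> (\<Sum>x\<in>{x\<in>bessel_zeros m. x \<le> R}. 1 / (t + x)\<^sup>2)"
    unfolding s_def bessel_zeros_atMost[OF m]
  proof (rule real_Hurwitz_sum)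
    show "uniform_limit {0..R} (\<lambda>n. poly (scaled_laguerre m n)) (\<lambda>x. bessel_series m (-x)) sequentially"
      by (rule uniform_limit_on_subset[OF scaled_laguerre_uniform_limit[where R = R]]) (use R in auto)
    show "uniform_limit {0..R} (\<lambda>n. poly (pderiv (scaled_laguerre m n))) (\<lambda>x. - bessel_series (m + 1) (-x)) sequentially"
      by (rule uniform_limit_on_subset[OF pderiv_scaled_laguerre_uniform_limit[where R = R]]) (use R in auto)
    show "((\<lambda>x. bessel_series m (-x)) has_real_derivative - bessel_series (m + 1) (-x)) (at x)" for x
      by (auto intro!: derivative_eq_intros)
    show "continuous_on {0..R} (\<lambda>x. - bessel_series (m + 1) (-x))"
      by (intro continuous_at_imp_continuous_on ballI continuous_intros isCont_o2[OF _ isCont_bessel_series])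
    show "bessel_series m (-0) \<noteq> 0" "bessel_series m (-R) \<noteq> 0"
      using R bessel_series_0_pos[OF m] by auto
    fix x assume x: "x \<in> {0..R}"
    show "- bessel_series (m + 1) (-x) \<noteq> 0" if "bessel_series m (-x) = 0"
    proof -
      have "x \<noteq> 0" using that bessel_series_0_pos[OF m] by auto
      thus ?thesis using bessel_series_zero_simple[OF m, of x] that x by auto
    qed
  next
    fix x assume x: "x \<in> {0..R}"
    show "isCont (\<lambda>x. 1 / (t + x)\<^sup>2) x"
      by (intro continuous_intros) (use x t in auto)
  next
    show "finite {x\<in>{0..R}. poly (scaled_laguerre m n) x = 0}" for n
      using finite_scaled_laguerre_zeros[OF m, of n] unfolding scaled_laguerre_zeros_def by (rule rev_finite_subset) auto
  qed (rule poly_DERIV)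
  have a_lim: "a \<longlonglongrightarrow> neg_log_deriv2 m t"
  proof -
    have "- t \<in> {-t..t}" using t by auto
    note L = tendsto_uniform_limitI[OF _ this]
    have "a = (\<lambda>n. (- poly (pderiv (scaled_laguerre m n)) (-t) / poly (scaled_laguerre m n) (-t))\<^sup>2 - poly (pderiv (pderiv (scaled_laguerre m n))) (-t) / poly (scaled_laguerre m n) (-t))"
      by (simp add: a_def)
    moreover have "\<dots> \<longlonglongrightarrow> neg_log_deriv2 m t"
      unfolding neg_log_deriv2_def
      using L[OF scaled_laguerre_uniform_limit] tendsto_minus[OF L[OF pderiv_scaled_laguerre_uniform_limit]] L[OF pderiv2_scaled_laguerre_uniform_limit]
        bessel_series_pos[OF m, of t] t
      by (intro tendsto_diff tendsto_power tendsto_divide) (auto simp del: of_nat_Suc)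
    ultimately show ?thesis by simp
  qed
  have a_eq: "a n = (\<Sum>x\<in>scaled_laguerre_zeros m n. 1 / (t + x)\<^sup>2)" for n
  proof -
    obtain c where c: "c \<noteq> 0" "scaled_laguerre m n = smult c (\<Prod>x\<in>scaled_laguerre_zeros m n. [:-x, 1:])"
      using scaled_laguerre_factor[OF m] by blast
    have "-t \<notin> scaled_laguerre_zeros m n" using scaled_laguerre_zeros_pos[OF m, of "-t" n] t by auto
    from log_deriv_prod_roots(3)[OF finite_scaled_laguerre_zeros[OF m] c(2,1) this]
    have "a n = (\<Sum>x\<in>scaled_laguerre_zeros m n. 1 / (-t - x)\<^sup>2)" by (simp only: a_def)
    also have "\<dots> = (\<Sum>x\<in>scaled_laguerre_zeros m n. 1 / (t + x)\<^sup>2)"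
      by (intro sum.cong refl) (simp add: power2_eq_square algebra_simps)
    finally show ?thesis .
  qed
  have s_eq: "s n = (\<Sum>x\<in>{x\<in>scaled_laguerre_zeros m n. x \<le> R}. 1 / (t + x)\<^sup>2)" for n
    unfolding s_def using scaled_laguerre_zeros_pos[OF m, of _ n]
    by (intro sum.cong) (auto simp: scaled_laguerre_zeros_def less_imp_le)
  have split: "a n = s n + (\<Sum>x\<in>{x\<in>scaled_laguerre_zeros m n. x > R}. 1 / (t + x)\<^sup>2)" for n
    unfolding a_eq s_eq using finite_scaled_laguerre_zeros[OF m, of n]
    by (subst sum.union_disjoint[symmetric]) (auto intro!: sum.cong)
  have tail0: "0 \<le> (\<Sum>x\<in>{x\<in>scaled_laguerre_zeros m n. x > R}. 1 / (t + x)\<^sup>2)" for n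
    by (intro sum_nonneg) auto
  have tail: "(\<Sum>x\<in>{x\<in>scaled_laguerre_zeros m n. x > R}. 1 / (t + x)\<^sup>2) \<le> 1 / (R * (m + 1))" for n
  proof -
    have "(\<Sum>x\<in>{x\<in>scaled_laguerre_zeros m n. x > R}. 1 / (t + x)\<^sup>2) \<le> (\<Sum>x\<in>{x\<in>scaled_laguerre_zeros m n. x > R}. 1 / R * (1 / x))"
    proof (rule sum_mono)
      fix x assume "x \<in> {x\<in>scaled_laguerre_zeros m n. x > R}"
      hence x: "x > R" by simp
      have "R * x \<le> (t + x) * (t + x)" using x R t by (intro mult_mono) auto
      thus "1 / (t + x)\<^sup>2 \<le> 1 / R * (1 / x)"
        using x R by (simp add: power2_eq_square frac_le)
    qed
    also have "\<dots> \<le> (\<Sum>x\<in>scaled_laguerre_zeros m n. 1 / R * (1 / x))"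
      using finite_scaled_laguerre_zeros[OF m] scaled_laguerre_zeros_pos[OF m] R by (intro sum_mono2) (auto intro: less_imp_le)
    also have "\<dots> = 1 / (R * (m + 1))"
      by (simp only: sum_distrib_left[symmetric] sum_inverse_scaled_laguerre_zeros[OF m]) simp
    finally show ?thesis .
  qed
  show "(\<Sum>x\<in>{x\<in>bessel_zeros m. x \<le> R}. 1 / (t + x)\<^sup>2) \<le> neg_log_deriv2 m t"
    by (rule LIMSEQ_le[OF s_lim a_lim]) (use split tail0 in auto)
  show "neg_log_deriv2 m t \<le> (\<Sum>x\<in>{x\<in>bessel_zeros m. x \<le> R}. 1 / (t + x)\<^sup>2) + 1 / (R * (m + 1))"
    by (rule LIMSEQ_le[OF a_lim tendsto_add[OF s_lim tendsto_const]]) (use split tail in auto)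
qed

lemma obtain_nonzero_radius:
  assumes m: "m > -1"
  obtains R where "R > R0" "R > 0" "bessel_series m (-R) \<noteq> 0"
proof -
  define a where "a = max 0 R0"
  have "infinite {a<..<a+1}" by (rule infinite_Ioo) simp
  moreover have "finite {x\<in>bessel_zeros m. x \<le> a + 1}" by (rule finite_bessel_zeros_atMost[OF m])
  ultimately have "\<not> {a<..<a+1} \<subseteq> {x\<in>bessel_zeros m. x \<le> a + 1}" using finite_subset by blast
  then obtain R where "R \<in> {a<..<a+1}" "R \<notin> bessel_zeros m"
    by (auto simp: subset_iff less_imp_le)
  thus ?thesis using that[of R] by (auto simp: a_def bessel_zeros_def)
qed

text \<open>
  The terms are positive, so the sum over any finite set that contains the zeros below \<open>R\<close> lies
  between the two bounds for partial sums, whose distance is \<open>O(1/R)\<close>.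
\<close>
lemma bessel_zeros_has_sum:
  assumes m: "m > -1" and t: "t > 0"
  shows "((\<lambda>x. 1 / (t + x)\<^sup>2) has_sum neg_log_deriv2 m t) (bessel_zeros m)"
  unfolding has_sum_def
proof (rule tendstoI)
  fix \<epsilon> :: real assume \<epsilon>: "\<epsilon> > 0"
  obtain R where R: "R > 1 / (\<epsilon> * (m + 1))" "R > 0" "bessel_series m (-R) \<noteq> 0"
    using obtain_nonzero_radius[OF m] by blast
  define X where "X = {x\<in>bessel_zeros m. x \<le> R}"
  have finX: "finite X" unfolding X_def by (rule finite_bessel_zeros_atMost[OF m])
  have "1 < R * (\<epsilon> * (m + 1))" using R(1) \<epsilon> m by (subst (asm) divide_less_eq) auto
  hence small: "1 / (R * (m + 1)) < \<epsilon>" using R(2) m by (subst divide_less_eq) (auto simp: mult_ac)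
  show "\<forall>\<^sub>F Y in finite_subsets_at_top (bessel_zeros m). dist (\<Sum>x\<in>Y. 1 / (t + x)\<^sup>2) (neg_log_deriv2 m t) < \<epsilon>"
    unfolding eventually_finite_subsets_at_top
  proof (intro exI[of _ X] conjI allI impI finX)
    show "X \<subseteq> bessel_zeros m" by (auto simp: X_def)
    fix Y assume "finite Y \<and> X \<subseteq> Y \<and> Y \<subseteq> bessel_zeros m"
    hence Y: "finite Y" "X \<subseteq> Y" "Y \<subseteq> bessel_zeros m" by auto
    obtain Q where Q: "Q > Max (insert 0 Y)" "Q > 0" "bessel_series m (-Q) \<noteq> 0"
      using obtain_nonzero_radius[OF m] by blast
    have YQ: "Y \<subseteq> {x\<in>bessel_zeros m. x \<le> Q}"
      using Y Q(1) by (auto simp: less_imp_le)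
    have "(\<Sum>x\<in>X. 1 / (t + x)\<^sup>2) \<le> (\<Sum>x\<in>Y. 1 / (t + x)\<^sup>2)"
      using Y by (intro sum_mono2) auto
    moreover have "(\<Sum>x\<in>Y. 1 / (t + x)\<^sup>2) \<le> (\<Sum>x\<in>{x\<in>bessel_zeros m. x \<le> Q}. 1 / (t + x)\<^sup>2)"
      using YQ finite_bessel_zeros_atMost[OF m] by (intro sum_mono2) auto
    moreover note bessel_zeros_partial_sum(1)[OF m t Q(2,3)]
      bessel_zeros_partial_sum(2)[OF m t R(2,3), folded X_def] small
    ultimately show "dist (\<Sum>x\<in>Y. 1 / (t + x)\<^sup>2) (neg_log_deriv2 m t) < \<epsilon>"
      unfolding dist_real_def by linarith
  qed
qed

text \<open>
  If there were only \<open>N\<close> zeros, the expansion would give \<open>0 \<le> -L' \<le> N / t\<^sup>2\<close> for the logarithmic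
  derivative \<open>L\<close> at positive \<open>t\<close>.  The Riccati equation \<open>t (L' + L\<^sup>2) + (m + 1) L = 1\<close> then forces
  \<open>L\<close> to tend to \<open>0\<close> and hence \<open>t L\<^sup>2\<close> to tend to \<open>1\<close>; but integrating the bound on \<open>L'\<close> from infinity
  gives \<open>L \<le> N / t\<close>, so \<open>t L\<^sup>2\<close> tends to \<open>0\<close>.
\<close>
lemma infinite_bessel_zeros:
  assumes m: "m > -1"
  shows "infinite (bessel_zeros m)"
proof
  assume fin: "finite (bessel_zeros m)"
  define N where "N = real (card (bessel_zeros m))"
  define G where "G = neg_log_deriv2 m"
  define L where "L = (\<lambda>t. bessel_series (m + 1) t / bessel_series m t)"
  have N0: "N \<ge> 0" by (simp add: N_def)
  have pos: "bessel_series m t > 0" if "t \<ge> 0" for t using bessel_series_pos[OF m that] .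
  have Lpos: "L t > 0" if "t \<ge> 0" for t
    using pos[OF that] bessel_series_pos[of "m+1" t] that m by (simp add: L_def)
  have G: "0 \<le> G t" "G t \<le> N / t\<^sup>2" if t: "t > 0" for t
  proof -
    have eq: "G t = (\<Sum>x\<in>bessel_zeros m. 1 / (t + x)\<^sup>2)"
      using has_sum_unique[OF bessel_zeros_has_sum[OF m t] has_sum_finite[OF fin]] by (simp add: G_def)
    show "0 \<le> G t" unfolding eq by (intro sum_nonneg) auto
    have "(\<Sum>x\<in>bessel_zeros m. 1 / (t + x)\<^sup>2) \<le> (\<Sum>x\<in>bessel_zeros m. 1 / t\<^sup>2)"
      using t by (intro sum_mono divide_left_mono power_mono) (auto simp: bessel_zeros_def)
    thus "G t \<le> N / t\<^sup>2" unfolding eq by (simp add: N_def)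
  qed
  have riccati: "t * (L t)\<^sup>2 = 1 + t * G t - (m + 1) * L t" if t: "t > 0" for t
  proof -
    have "bessel_series m t / bessel_series m t =
        ((m + 1) * bessel_series (m + 1) t + t * bessel_series (m + 2) t) / bessel_series m t"
      by (subst (1) bessel_series_rec) (rule refl)
    hence "1 = (m + 1) * L t + t * (bessel_series (m + 2) t / bessel_series m t)"
      using pos[of t] t by (simp add: L_def add_divide_distrib)
    moreover have "bessel_series (m + 2) t / bessel_series m t = (L t)\<^sup>2 - G t"
      by (simp add: G_def neg_log_deriv2_def L_def)
    ultimately have "1 = (m + 1) * L t + t * ((L t)\<^sup>2 - G t)" by (simp only:)
    thus ?thesis by (simp add: algebra_simps)
  qed
  have tG: "((\<lambda>t. t * G t) \<longlongrightarrow> 0) at_top"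
  proof (rule tendsto_sandwich[OF _ _ tendsto_const])
    show "\<forall>\<^sub>F t in at_top. 0 \<le> t * G t" using eventually_gt_at_top[of 0] by eventually_elim (use G in auto)
    show "\<forall>\<^sub>F t in at_top. t * G t \<le> N / t" using eventually_gt_at_top[of 0]
    proof eventually_elim
      case (elim t)
      have "t * G t \<le> t * (N / t\<^sup>2)" using G(2)[OF elim] elim by (intro mult_left_mono) auto
      thus ?case using elim by (simp add: power2_eq_square)
    qed
    show "((\<lambda>t. N / t) \<longlongrightarrow> 0) at_top" by real_asymp
  qed
  have L0: "(L \<longlongrightarrow> 0) at_top"
  proof (rule tendsto_sandwich[OF _ _ tendsto_const])
    show "\<forall>\<^sub>F t in at_top. 0 \<le> L t" using eventually_ge_at_top[of 0] by eventually_elim (use Lpos less_imp_le in auto)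
    show "\<forall>\<^sub>F t in at_top. L t \<le> sqrt ((1 + N) / t)" using eventually_ge_at_top[of 1]
    proof eventually_elim
      case (elim t)
      have "t * G t \<le> N"
      proof -
        have "t * G t \<le> t * (N / t\<^sup>2)" using G(2)[of t] elim by (intro mult_left_mono) auto
        also have "\<dots> = N / t" using elim by (simp add: power2_eq_square)
        also have "\<dots> \<le> N / 1" using elim N0 by (intro divide_left_mono) auto
        finally show ?thesis by simp
      qed
      moreover have "0 \<le> (m + 1) * L t" using Lpos[of t] elim m by simp
      ultimately have "t * (L t)\<^sup>2 \<le> 1 + N" using riccati[of t] elim by linarith
      hence "(L t)\<^sup>2 \<le> (1 + N) / t" using elim by (simp add: field_simps)
      thus ?case by (rule real_le_rsqrt)
    qed
    show "((\<lambda>t. sqrt ((1 + N) / t)) \<longlongrightarrow> 0) at_top" 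
      using N0 by real_asymp
  qed
  have "((\<lambda>t. 1 + t * G t - (m + 1) * L t) \<longlongrightarrow> 1 + 0 - (m + 1) * 0) at_top"
    by (intro tendsto_intros tG L0)
  moreover have "\<forall>\<^sub>F t in at_top. 1 + t * G t - (m + 1) * L t = t * (L t)\<^sup>2"
    using eventually_gt_at_top[of 0] by eventually_elim (use riccati in auto)
  ultimately have "((\<lambda>t. t * (L t)\<^sup>2) \<longlongrightarrow> 1 + 0 - (m + 1) * 0) at_top"
    by (rule Lim_transform_eventually)
  hence lim1: "((\<lambda>t. t * (L t)\<^sup>2) \<longlongrightarrow> 1) at_top" by simp
  have dL: "(L has_real_derivative - G t) (at t)" if "t \<ge> 0" for t
    unfolding L_def G_def neg_log_deriv2_def using pos[OF that]
    by (auto intro!: derivative_eq_intros simp: field_simps power2_eq_square add.assoc)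
  have LN: "L t \<le> N / t" if t: "t > 0" for t
  proof -
    have "L t - N / t \<le> 0"
    proof (rule tendsto_lowerbound)
      have "((\<lambda>u. N / u) \<longlongrightarrow> 0) at_top" by real_asymp
      thus "((\<lambda>u. L u - N / u) \<longlongrightarrow> 0) at_top" using tendsto_diff[OF L0] by fastforce
      show "\<forall>\<^sub>F u in at_top. L t - N / t \<le> L u - N / u" using eventually_ge_at_top[of t]
      proof eventually_elim
        case (elim u)
        show ?case
        proof (rule DERIV_nonneg_imp_nondecreasing[OF elim])
          fix v assume v: "t \<le> v" "v \<le> u"
          have "((\<lambda>u. L u - N / u) has_real_derivative - G v + N / v\<^sup>2) (at v)"
            using v t by (auto intro!: derivative_eq_intros dL simp: power2_eq_square)
          moreover have "- G v + N / v\<^sup>2 \<ge> 0" using G(2)[of v] v t by simp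
          ultimately show "\<exists>y. ((\<lambda>u. L u - N / u) has_real_derivative y) (at v) \<and> 0 \<le> y" by blast
        qed
      qed
    qed auto
    thus ?thesis by simp
  qed
  have "((\<lambda>t. t * (L t)\<^sup>2) \<longlongrightarrow> 0) at_top"
  proof (rule tendsto_sandwich[OF _ _ tendsto_const])
    show "\<forall>\<^sub>F t in at_top. 0 \<le> t * (L t)\<^sup>2" using eventually_ge_at_top[of 0] by eventually_elim auto
    show "\<forall>\<^sub>F t in at_top. t * (L t)\<^sup>2 \<le> N\<^sup>2 / t" using eventually_gt_at_top[of 0]
    proof eventually_elim
      case (elim t)
      have "t * (L t)\<^sup>2 \<le> t * (N / t)\<^sup>2"
        using LN[OF elim] Lpos[of t] elim by (intro mult_left_mono power_mono) auto
      also have "\<dots> = N\<^sup>2 / t" using elim by (simp add: power2_eq_square)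
      finally show ?case .
    qed
    show "((\<lambda>t. N\<^sup>2 / t) \<longlongrightarrow> 0) at_top" by real_asymp
  qed
  with lim1 have "(1::real) = 0" by (rule tendsto_unique[rotated]) simp
  thus False by simp
qed

section \<open>Enumerating the zeros\<close>

text \<open>
  The successor of \<open>a\<close> in \<open>W\<close> exists since \<open>W\<close> is unbounded, and it is a minimum of a finite set;
  so every positive rank is attained.
\<close>
lemma bij_betw_rank:
  fixes W :: "real set"
  assumes inf: "infinite W" and fin: "\<And>x. finite {y\<in>W. y \<le> x}"
  shows "bij_betw (\<lambda>k. THE x. x \<in> W \<and> card {y\<in>W. y \<le> x} = Suc k) UNIV W"
proof -
  define r where "r = (\<lambda>x. card {y\<in>W. y \<le> x})"
  have mono: "r x < r y" if "x < y" "y \<in> W" for x y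
  proof -
    have "y \<in> {u\<in>W. u \<le> y}" "y \<notin> {u\<in>W. u \<le> x}" "{u\<in>W. u \<le> x} \<subseteq> {u\<in>W. u \<le> y}" using that by auto
    hence "{u\<in>W. u \<le> x} \<subset> {u\<in>W. u \<le> y}" by blast
    thus ?thesis unfolding r_def by (rule psubset_card_mono[OF fin])
  qed
  have inj: "x = y" if "x \<in> W" "y \<in> W" "r x = r y" for x y
    using mono[of x y] mono[of y x] that by (cases x y rule: linorder_cases) auto
  have next_elt: "\<exists>x\<in>W. x > a \<and> r x = Suc (r a)" for a
  proof -
    have "\<not> W \<subseteq> {y\<in>W. y \<le> a}" using inf fin finite_subset by blast
    then obtain b where "b \<in> W" "\<not> b \<le> a" by blast
    hence b: "b \<in> W" "b > a" by auto
    define M where "M = {y\<in>W. a < y \<and> y \<le> b}"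
    have M: "finite M" "b \<in> M" using b fin[of b] by (auto simp: M_def elim: rev_finite_subset)
    define x where "x = Min M"
    have x: "x \<in> M" unfolding x_def using M by (intro Min_in) auto
    have "{y\<in>W. y \<le> x} = insert x {y\<in>W. y \<le> a}"
    proof (intro equalityI subsetI)
      fix y assume y: "y \<in> {y\<in>W. y \<le> x}"
      show "y \<in> insert x {y\<in>W. y \<le> a}"
      proof (cases "y \<le> a")
        case False
        hence "y \<in> M" using y x by (auto simp: M_def)
        hence "x \<le> y" unfolding x_def using M by (intro Min_le) auto
        thus ?thesis using y by simp
      qed (use y in auto)
    qed (use x in \<open>auto simp: M_def\<close>)
    hence "r x = Suc (r a)" unfolding r_def using x fin[of a] by (simp add: M_def)
    thus ?thesis using x by (auto simp: M_def)
  qed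
  have ex: "\<exists>x\<in>W. r x = Suc k" for k
  proof (induction k)
    case 0
    obtain w where w: "w \<in> W" using inf by fastforce
    define M where "M = {y\<in>W. y \<le> w}"
    have M: "finite M" "w \<in> M" using w fin[of w] by (auto simp: M_def)
    have "{y\<in>W. y \<le> Min M} = {Min M}"
    proof (intro equalityI subsetI)
      fix y assume y: "y \<in> {y\<in>W. y \<le> Min M}"
      have "Min M \<le> w" using M by simp
      hence "y \<in> M" using y by (auto simp: M_def)
      hence "Min M \<le> y" using M by simp
      thus "y \<in> {Min M}" using y by simp
    qed (use M Min_in[of M] in \<open>auto simp: M_def\<close>)
    thus ?case using M Min_in[of M] by (intro bexI[of _ "Min M"]) (auto simp: r_def M_def)
  next
    case (Suc k)
    thus ?case using next_elt by metis
  qed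
  have the: "(THE x. x \<in> W \<and> r x = Suc k) \<in> W \<and> r (THE x. x \<in> W \<and> r x = Suc k) = Suc k" for k
    by (rule theI') (use ex inj in metis)
  have "bij_betw (\<lambda>k. THE x. x \<in> W \<and> r x = Suc k) UNIV W"
  proof (rule bij_betw_imageI)
    show "inj (\<lambda>k. THE x. x \<in> W \<and> r x = Suc k)"
      by (rule injI) (metis the nat.inject)
    show "range (\<lambda>k. THE x. x \<in> W \<and> r x = Suc k) = W"
    proof (intro equalityI subsetI)
      fix w assume w: "w \<in> W"
      hence "r w > 0" unfolding r_def using fin[of w] by (auto simp: card_gt_0_iff)
      then obtain k where k: "r w = Suc k" using gr0_implies_Suc by blast
      hence "(THE x. x \<in> W \<and> r x = Suc k) = w" using the[of k] inj w by metis
      thus "w \<in> range (\<lambda>k. THE x. x \<in> W \<and> r x = Suc k)" by blast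
    qed (use the in auto)
  qed
  thus ?thesis by (simp add: r_def)
qed

lemma bessel_J_zero_iff:
  assumes "x > 0" shows "bessel_J m x = 0 \<longleftrightarrow> x\<^sup>2 / 4 \<in> bessel_zeros m"
  using assms by (simp add: bessel_J_eq bessel_zeros_def)

lemma bij_betw_bessel_J_zero:
  assumes m: "m > -1"
  shows "bij_betw (\<lambda>k. (bessel_J_zero m (Suc k))\<^sup>2 / 4) UNIV (bessel_zeros m)"
proof -
  define W where "W = {x. 0 < x \<and> bessel_J m x = 0}"
  have q: "bij_betw (\<lambda>x. x\<^sup>2 / 4) W (bessel_zeros m)"
  proof (rule bij_betw_byWitness[where f' = "\<lambda>z. 2 * sqrt z"])
    show "\<forall>x\<in>W. 2 * sqrt (x\<^sup>2 / 4) = x" by (auto simp: W_def real_sqrt_divide)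
    show "\<forall>z\<in>bessel_zeros m. (2 * sqrt z)\<^sup>2 / 4 = z" by (auto simp: bessel_zeros_def power_mult_distrib)
    show "(\<lambda>x. x\<^sup>2 / 4) ` W \<subseteq> bessel_zeros m" by (auto simp: W_def bessel_J_zero_iff)
    show "(\<lambda>z. 2 * sqrt z) ` bessel_zeros m \<subseteq> W"
      by (auto simp: W_def bessel_J_zero_iff bessel_zeros_def power_mult_distrib)
  qed
  have "infinite W" using bij_betw_finite[OF q] infinite_bessel_zeros[OF m] by simp
  moreover have "finite {y\<in>W. y \<le> x}" for x
  proof (rule finite_imageD)
    have "(\<lambda>x. x\<^sup>2 / 4) ` {y\<in>W. y \<le> x} \<subseteq> {z\<in>bessel_zeros m. z \<le> x\<^sup>2 / 4}"
      by (auto simp: W_def bessel_J_zero_iff intro: power_mono)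
    thus "finite ((\<lambda>x. x\<^sup>2 / 4) ` {y\<in>W. y \<le> x})"
      using finite_bessel_zeros_atMost[OF m] finite_subset by blast
    show "inj_on (\<lambda>x. x\<^sup>2 / 4) {y\<in>W. y \<le> x}"
      using bij_betw_imp_inj_on[OF q] by (rule inj_on_subset) auto
  qed
  ultimately have "bij_betw (\<lambda>k. THE x. x \<in> W \<and> card {y\<in>W. y \<le> x} = Suc k) UNIV W"
    by (rule bij_betw_rank)
  moreover have "(THE x. x \<in> W \<and> card {y\<in>W. y \<le> x} = Suc k) = bessel_J_zero m (Suc k)" for k
  proof -
    have "{y\<in>W. y \<le> x} = {y. 0 < y \<and> y \<le> x \<and> bessel_J m y = 0}" for x by (auto simp: W_def)
    thus ?thesis unfolding bessel_J_zero_def W_def by (simp add: conj_ac)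
  qed
  ultimately have "bij_betw (\<lambda>k. bessel_J_zero m (Suc k)) UNIV W" by simp
  from bij_betw_trans[OF this q] show ?thesis by (simp add: o_def)
qed

section \<open>The zero of the derivative and the evaluation\<close>
lemma deriv_bessel_I:
  assumes x: "x > 0"
  shows "deriv (bessel_I \<nu>) x =
    (x / 2) powr \<nu> / x * (\<nu> * bessel_series \<nu> (x\<^sup>2 / 4) + 2 * (x\<^sup>2 / 4) * bessel_series (\<nu> + 1) (x\<^sup>2 / 4))"
proof (rule DERIV_imp_deriv)
  have "(x / 2) powr (\<nu> - 1) = (x / 2) powr \<nu> * 2 / x" using x by (simp add: powr_diff)
  thus "(bessel_I \<nu> has_real_derivative (x / 2) powr \<nu> / x *
      (\<nu> * bessel_series \<nu> (x\<^sup>2 / 4) + 2 * (x\<^sup>2 / 4) * bessel_series (\<nu> + 1) (x\<^sup>2 / 4))) (at x)"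
    unfolding bessel_I_eq[abs_def] using x
    by (auto intro!: derivative_eq_intros simp: field_simps power2_eq_square)
qed

text \<open>
  In the variable \<open>t = x\<^sup>2/4\<close> the zero condition is \<open>h t = 0\<close>, where all power series coefficients of \<open>h\<close>
  except the constant one are positive.  So \<open>h\<close> increases with slope bounded below from a negative
  value, and has exactly one zero.
\<close>
lemma bessel_I_deriv_zero:
  assumes \<nu>: "-1 < \<nu>" "\<nu> < 0"
  defines "a \<equiv> bessel_I_deriv_zero \<nu>"
  shows "a > 0" and "\<nu> * bessel_series \<nu> (a\<^sup>2 / 4) + 2 * (a\<^sup>2 / 4) * bessel_series (\<nu> + 1) (a\<^sup>2 / 4) = 0"
proof -
  define h where "h = (\<lambda>t. \<nu> * bessel_series \<nu> t + 2 * t * bessel_series (\<nu> + 1) t)"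
  define h' where "h' = (\<lambda>t. (\<nu> + 2) * bessel_series (\<nu> + 1) t + 2 * t * bessel_series (\<nu> + 2) t)"
  have dh: "(h has_real_derivative h' t) (at t)" for t
    unfolding h_def h'_def by (auto intro!: derivative_eq_intros simp: add.assoc algebra_simps)
  define c where "c = (\<nu> + 2) * bessel_series (\<nu> + 1) 0"
  have c: "c > 0" unfolding c_def using \<nu> bessel_series_0_pos[of "\<nu>+1"] by simp
  have h'c: "h' t \<ge> c" if t: "t \<ge> 0" for t
  proof -
    have "(\<nu> + 2) * bessel_series (\<nu> + 1) t \<ge> c"
      unfolding c_def using \<nu> t by (intro mult_left_mono bessel_series_ge_0) auto
    moreover have "2 * t * bessel_series (\<nu> + 2) t \<ge> 0"
      using bessel_series_pos[of "\<nu>+2" t] t \<nu> by simp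
    ultimately show ?thesis unfolding h'_def by linarith
  qed
  have smono: "h s < h t" if "0 \<le> s" "s < t" for s t
    by (rule DERIV_pos_imp_increasing[OF that(2)]) (use dh h'c c that in \<open>meson less_le_trans order_trans\<close>)
  have h0: "h 0 < 0" unfolding h_def using \<nu> bessel_series_0_pos[of \<nu>] by (simp add: mult_neg_pos)
  \<comment> \<open>\<open>h\<close> grows with slope at least \<open>c\<close>, so it is nonnegative at this point\<close>
  define T where "T = - h 0 / c"
  have T: "T > 0" unfolding T_def using h0 c by (simp add: divide_neg_pos)
  have "h T \<ge> 0"
  proof -
    have "h 0 - c * 0 \<le> h T - c * T"
    proof (rule DERIV_nonneg_imp_nondecreasing[of 0 T "\<lambda>t. h t - c * t"])
      fix t assume "0 \<le> t" "t \<le> T"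
      moreover have "((\<lambda>t. h t - c * t) has_real_derivative h' t - c) (at t)"
        by (auto intro!: derivative_eq_intros dh)
      ultimately show "\<exists>y. ((\<lambda>t. h t - c * t) has_real_derivative y) (at t) \<and> 0 \<le> y" using h'c by force
    qed (use T in auto)
    thus ?thesis using c by (simp add: T_def)
  qed
  then obtain t where t: "0 \<le> t" "h t = 0"
    using IVT'[of h 0 0 T] h0 T DERIV_isCont[OF dh] by (force intro: continuous_at_imp_continuous_on)
  have "t > 0" using t h0 by (cases "t = 0") auto
  have iff: "deriv (bessel_I \<nu>) x = 0 \<longleftrightarrow> h (x\<^sup>2 / 4) = 0" if "x > 0" for x
    using that by (simp add: deriv_bessel_I h_def)
  have "\<exists>!x. 0 < x \<and> deriv (bessel_I \<nu>) x = 0"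
  proof (rule ex1I[of _ "2 * sqrt t"])
    show "0 < 2 * sqrt t \<and> deriv (bessel_I \<nu>) (2 * sqrt t) = 0"
      using t \<open>t > 0\<close> by (simp add: iff power_mult_distrib)
    fix x assume x: "0 < x \<and> deriv (bessel_I \<nu>) x = 0"
    hence "h (x\<^sup>2 / 4) = 0" using iff by blast
    hence "x\<^sup>2 / 4 = t" using smono[of "x\<^sup>2 / 4" t] smono[of t "x\<^sup>2 / 4"] t
      by (cases "x\<^sup>2 / 4" t rule: linorder_cases) auto
    hence "t = (x / 2)\<^sup>2" by (simp add: power_divide)
    thus "x = 2 * sqrt t" using x by simp
  qed
  from theI'[OF this] have *: "0 < a \<and> deriv (bessel_I \<nu>) a = 0"
    unfolding a_def bessel_I_deriv_zero_def .
  thus "a > 0" by simp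
  show "\<nu> * bessel_series \<nu> (a\<^sup>2 / 4) + 2 * (a\<^sup>2 / 4) * bessel_series (\<nu> + 1) (a\<^sup>2 / 4) = 0"
    using * iff[of a] by (simp add: h_def)
qed

text \<open>
  The condition fixes \<open>F_\<nu> / F_(\<nu>+1)\<close>, and then the three-term recurrence, used twice, fixes all
  the quotients that occur.
\<close>
lemma neg_log_deriv2_at_deriv_zero:
  assumes \<nu>: "-1 < \<nu>" "\<nu> < 0" and t: "t > 0"
    and zero: "\<nu> * bessel_series \<nu> t + 2 * t * bessel_series (\<nu> + 1) t = 0"
  shows "neg_log_deriv2 (\<nu> + 1) t = 4 / \<nu>\<^sup>2 + 1 / t - (\<nu> + 1) / t\<^sup>2"
proof -
  define f where "f = bessel_series (\<nu> + 1) t"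
  have f: "f > 0" unfolding f_def using \<nu> t by (intro bessel_series_pos) auto
  define p where "p = bessel_series (\<nu> + 2) t / f"
  define q where "q = bessel_series (\<nu> + 3) t / f"
  have F: "bessel_series \<nu> t = - (2 * t / \<nu>) * f"
    using zero \<nu> by (simp add: f_def field_simps)
  have "bessel_series \<nu> t = (\<nu> + 1) * f + t * (p * f)"
    using bessel_series_rec[of \<nu> t] f by (simp add: f_def p_def)
  hence "(- (2 * t / \<nu>)) * f = ((\<nu> + 1) + t * p) * f" unfolding F by (simp add: algebra_simps)
  hence "- (2 * t / \<nu>) = (\<nu> + 1) + t * p" using f by (simp only: mult_cancel_right) auto
  hence p: "p = - 2 / \<nu> - (\<nu> + 1) / t" using t by (simp add: field_simps)
  have "f = (\<nu> + 2) * (p * f) + t * (q * f)"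
    using bessel_series_rec[of "\<nu> + 1" t] f by (simp add: f_def p_def q_def add.assoc)
  hence "1 * f = ((\<nu> + 2) * p + t * q) * f" by (simp add: algebra_simps)
  hence "1 = (\<nu> + 2) * p + t * q" using f by simp
  hence q: "q = (1 - (\<nu> + 2) * p) / t" using t by (simp add: field_simps)
  have "neg_log_deriv2 (\<nu> + 1) t = p\<^sup>2 - q"
    by (simp add: neg_log_deriv2_def p_def q_def f_def add.assoc)
  also have "\<dots> = 4 / \<nu>\<^sup>2 + 1 / t - (\<nu> + 1) / t\<^sup>2"
    unfolding q p using \<nu> t by (simp add: field_simps power2_eq_square)
  finally show ?thesis .
qed

theorem mainTheorem16:
  fixes \<nu> :: real
  assumes "-1 < \<nu>" and "\<nu> < 0"
  shows "(\<lambda>k. 1 / ((bessel_I_deriv_zero \<nu>)\<^sup>2 + (bessel_J_zero (\<nu> + 1) (Suc k))\<^sup>2)\<^sup>2) sums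
     (1 / (4 * \<nu>\<^sup>2) + 1 / (4 * (bessel_I_deriv_zero \<nu>)\<^sup>2) - (\<nu> + 1) / (bessel_I_deriv_zero \<nu>) ^ 4)"
proof -
  define a where "a = bessel_I_deriv_zero \<nu>"
  define t where "t = a\<^sup>2 / 4"
  define j where "j = (\<lambda>k. bessel_J_zero (\<nu> + 1) (Suc k))"
  have a: "a > 0" "\<nu> * bessel_series \<nu> t + 2 * t * bessel_series (\<nu> + 1) t = 0"
    using bessel_I_deriv_zero[OF assms] by (simp_all add: a_def t_def)
  have t: "t > 0" using a by (simp add: t_def)
  have m: "\<nu> + 1 > -1" using assms by simp
  have "(\<lambda>k. 1 / (t + (j k)\<^sup>2 / 4)\<^sup>2) sums neg_log_deriv2 (\<nu> + 1) t"
    using bessel_zeros_has_sum[OF m t] has_sum_reindex_bij_betw[OF bij_betw_bessel_J_zero[OF m], of "\<lambda>x. 1 / (t + x)\<^sup>2"]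
    by (intro has_sum_imp_sums) (simp add: j_def)
  from sums_mult[OF this, of "1 / 16"]
  have "(\<lambda>k. 1 / 16 * (1 / (t + (j k)\<^sup>2 / 4)\<^sup>2)) sums (1 / 16 * (4 / \<nu>\<^sup>2 + 1 / t - (\<nu> + 1) / t\<^sup>2))"
    using neg_log_deriv2_at_deriv_zero[OF assms t a(2)] by simp
  moreover have "(\<lambda>k. 1 / 16 * (1 / (t + (j k)\<^sup>2 / 4)\<^sup>2)) = (\<lambda>k. 1 / (a\<^sup>2 + (j k)\<^sup>2)\<^sup>2)"
  proof
    fix k
    have "t + (j k)\<^sup>2 / 4 = (a\<^sup>2 + (j k)\<^sup>2) / 4" by (simp add: t_def)
    thus "1 / 16 * (1 / (t + (j k)\<^sup>2 / 4)\<^sup>2) = 1 / (a\<^sup>2 + (j k)\<^sup>2)\<^sup>2"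
      by (simp only: power_divide) simp
  qed
  moreover have "1 / 16 * (4 / \<nu>\<^sup>2 + 1 / t - (\<nu> + 1) / t\<^sup>2) = 1 / (4 * \<nu>\<^sup>2) + 1 / (4 * a\<^sup>2) - (\<nu> + 1) / a ^ 4"
    using a(1) by (simp add: t_def power_divide power_mult[symmetric] algebra_simps)
  ultimately show ?thesis by (simp only: a_def j_def)
qed

end
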